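(* Let $E,H$ be complex Hilbert spaces, let $G_0:\mathcal{D}(G_0)\subseteq E\to H$ and $D_0:\mathcal{D}(D_0)\subseteq H\to E$ be densely defined closed linear operators with $G_0\subseteq -(D_0)^{\ast}$, and set $G:=-(D_0)^{\ast}\supseteq G_0$, $D:=-(G_0)^{\ast}\supseteq D_0$. Let $A\subseteq\begin{pmatrix}0 & D \\ G & 0\end{pmatrix}$ be a (possibly nonlinear) restriction, i.e. $\mathcal{D}(A)\subseteq\mathcal{D}(G)\times\mathcal{D}(D)$ is a subset and $A(u,w)=(Dw,Gu)$ for $(u,w)\in\mathcal{D}(A)$. Then the following statements are equivalent. (i) There exist Hilbert spaces $E_0,U$ and operators $L\in L(E_0,H)$, $K\in L(E_0,U)$ satisfying the Hypothesis such that $$\mathcal{D}(A)=\{(u,w)\in E_0\times H\,|\,K^{\diamond}Ku-L^{\diamond}w\in E\}.$$ (ii) There exists a relation $h\subseteq\mathcal{BD}(G)\oplus\mathcal{BD}(G)$ that is maximal monotone and selfadjoint such that $$\mathcal{D}(A)=\{(u,w)\in\mathcal{D}(G)\times\mathcal{D}(D)\,|\,(\pi_{\mathcal{BD}(G)}u,\stackrel{\bullet}{D}\pi_{\mathcal{BD}(D)}w)\in h\}.$$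
   Context: Conventions. All Hilbert spaces are complex; inner products $\langle\cdot|\cdot\rangle$ are conjugate linear in the first and linear in the second argument. $L(X,Y)$ denotes the bounded linear operators from $X$ to $Y$. For operators, $B\subseteq C$ means that $C$ extends $B$. Hypothesis. Hilbert spaces $E_0,U$ and operators $L\in L(E_0,H)$, $K\in L(E_0,U)$ are said to satisfy the Hypothesis if: (a) $E_0\subseteq E$ is a dense subspace with continuous embedding; (b) the operator $\begin{pmatrix}L \\ K\end{pmatrix}:E_0\subseteq E\to H\oplus U$, $u\mapsto(Lu,Ku)$, is closed as an operator from $E$ to $H\oplus U$ with domain $E_0$; (c) $G_0\subseteq L\subseteq G$, where $L$ is viewed as an operator from $E$ to $H$ with domain $E_0$ (so $\mathcal{D}(G_0)\subseteq E_0\subseteq\mathcal{D}(G)$), and $K|_{\mathcal{D}(G_0)}=0$. Dual operators. $L^{\diamond}:H\to E_0'$ and $K^{\diamond}:U\to E_0'$ are given by $(L^{\diamond}w)(x)=\langle w|Lx\rangle_H$ and $(K^{\diamond}z)(x)=\langle z|Kx\rangle_U$ for $x\in E_0$. The space $E$ is regarded as a subspace of $E_0'$ by identifying $e\in E$ with the functional $x\mapsto\langle e|x\rangle_E$ on $E_0$. Thus $K^{\diamond}Ku-L^{\diamond}w\in E$ means that there is $e\in E$ with $\langle Ku|Kx\rangle_U-\langle w|Lx\rangle_H=\langle e|x\rangle_E$ for all $x\in E_0$. Boundary data spaces. For a closed operator $C$, $\mathcal{D}_C$ denotes its domain as a Hilbert space with the graph inner product (e.g. $\langle x|y\rangle_{\mathcal{D}_G}=\langle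 x|y\rangle_E+\langle Gx|Gy\rangle_H$). Set $\mathcal{BD}(G):=\mathcal{D}(G_0)^{\perp}$ in $\mathcal{D}_G$ and $\mathcal{BD}(D):=\mathcal{D}(D_0)^{\perp}$ in $\mathcal{D}_D$, Hilbert spaces with the inherited graph inner products. $\pi_{\mathcal{BD}(G)}:\mathcal{D}_G\to\mathcal{BD}(G)$ and $\pi_{\mathcal{BD}(D)}:\mathcal{D}_D\to\mathcal{BD}(D)$ are the orthogonal projections. One has $\mathcal{BD}(G)=\ker(1-DG)$ and $\mathcal{BD}(D)=\ker(1-GD)$, so $D$ maps $\mathcal{BD}(D)$ into $\mathcal{BD}(G)$; $\stackrel{\bullet}{D}:\mathcal{BD}(D)\to\mathcal{BD}(G)$, $x\mapsto Dx$, denotes this restriction (a unitary operator). Relations. For a Hilbert space $Y$, a relation is a subset $C\subseteq Y\oplus Y$. It is monotone if $\operatorname{Re}\langle x-u|y-v\rangle\ge 0$ for all $(x,y),(u,v)\in C$, and maximal monotone if it is monotone and not properly contained in another monotone relation. The adjoint relation is $C^{\ast}=\{(x,y)\in Y\oplus Y\,|\,\langle v|x\rangle=\langle u|y\rangle\text{ for all }(u,v)\in C\}$; $C$ is selfadjoint if $C=C^{\ast}$. *)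

theory Defs
  imports "HOL-Analysis.Analysis"
begin

text \<open>
  Spaces such as $E_0 \subseteq E$ or $\mathcal{D}_G \subseteq E$ carry inner products of their own,
  and the theorem quantifies existentially over Hilbert spaces.  A Hilbert space is therefore a
  complex subspace of an ambient complex vector space (a type) together with an inner product on
  that subspace.
\<close>

class complex_vector = ab_group_add +
  fixes scaleC :: "complex \<Rightarrow> 'a \<Rightarrow> 'a" (infixr "*\<^sub>C" 75)
  assumes scaleC_add_right: "a *\<^sub>C (x + y) = a *\<^sub>C x + a *\<^sub>C y"
    and scaleC_add_left: "(a + b) *\<^sub>C x = a *\<^sub>C x + b *\<^sub>C x"
    and scaleC_scaleC: "a *\<^sub>C b *\<^sub>C x = (a * b) *\<^sub>C x"
    and scaleC_one: "1 *\<^sub>C x = x"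

global_interpretation complex_vector: vector_space "scaleC :: complex \<Rightarrow> 'a \<Rightarrow> 'a::complex_vector"
  by unfold_locales (simp_all add: scaleC_add_right scaleC_add_left scaleC_scaleC scaleC_one)

instantiation prod :: (complex_vector, complex_vector) complex_vector
begin
definition scaleC_prod_def: "c *\<^sub>C p = (c *\<^sub>C fst p, c *\<^sub>C snd p)"
instance
  by standard
    (simp_all add: scaleC_prod_def scaleC_add_right scaleC_add_left scaleC_scaleC scaleC_one)
end

record 'a hspace =
  hcarrier :: "'a set"
  hinner :: "'a \<Rightarrow> 'a \<Rightarrow> complex"

definition hnorm :: "'a hspace \<Rightarrow> 'a \<Rightarrow> real" where
  "hnorm X x = sqrt (Re (hinner X x x))"

text \<open>Cut off outside the carrier, because \<^locale>\<open>Metric_space\<close> asks for nonnegativity and symmetry of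
  the distance on the whole type.\<close>
definition hdist :: "'a::complex_vector hspace \<Rightarrow> 'a \<Rightarrow> 'a \<Rightarrow> real" where
  "hdist X x y = (if x \<in> hcarrier X \<and> y \<in> hcarrier X then hnorm X (x - y) else 0)"

abbreviation htopology :: "'a::complex_vector hspace \<Rightarrow> 'a topology" where
  "htopology X \<equiv> Metric_space.mtopology (hcarrier X) (hdist X)"

text \<open>The inner product is linear in the second argument and, by conjugate symmetry,
  conjugate linear in the first.\<close>
locale hilbert_space =
  fixes X :: "'a::complex_vector hspace"
  assumes subspace_carrier: "complex_vector.subspace (hcarrier X)"
    and hinner_commute:
      "\<And>x y. x \<in> hcarrier X \<Longrightarrow> y \<in> hcarrier X \<Longrightarrow> hinner X x y = cnj (hinner X y x)"
    and hinner_add_right: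
      "\<And>x y z. x \<in> hcarrier X \<Longrightarrow> y \<in> hcarrier X \<Longrightarrow> z \<in> hcarrier X \<Longrightarrow>
        hinner X x (y + z) = hinner X x y + hinner X x z"
    and hinner_scaleC_right:
      "\<And>c x y. x \<in> hcarrier X \<Longrightarrow> y \<in> hcarrier X \<Longrightarrow> hinner X x (c *\<^sub>C y) = c * hinner X x y"
    and hinner_pos: "\<And>x. x \<in> hcarrier X \<Longrightarrow> x \<noteq> 0 \<Longrightarrow> Re (hinner X x x) > 0"
    and complete: "Metric_space.mcomplete (hcarrier X) (hdist X)"

definition hsum ::
    "'a hspace \<Rightarrow> 'b hspace \<Rightarrow> ('a \<times> 'b) hspace" (infixr "\<oplus>\<^sub>H" 65) where
  "X \<oplus>\<^sub>H Y = \<lparr>hcarrier = hcarrier X \<times> hcarrier Y,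
     hinner = (\<lambda>(x, y) (u, v). hinner X x u + hinner Y y v)\<rparr>"

definition orth_compl :: "'a hspace \<Rightarrow> 'a set \<Rightarrow> 'a hspace" where
  "orth_compl X S = X\<lparr>hcarrier := {x \<in> hcarrier X. \<forall>s\<in>S. hinner X s x = 0}\<rparr>"

text \<open>\<open>orth_proj X S x\<close> is meaningful for a closed subspace \<open>S\<close> of \<open>X\<close> and \<open>x \<in> hcarrier X\<close>.\<close>
definition orth_proj :: "'a::complex_vector hspace \<Rightarrow> 'a set \<Rightarrow> 'a \<Rightarrow> 'a" where
  "orth_proj X S x = (THE p. p \<in> S \<and> (\<forall>s\<in>S. hinner X s (x - p) = 0))"

text \<open>\<open>bounded_ops X Y\<close> is $L(X,Y)$; only the values on the carrier of \<open>X\<close> matter.\<close>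
definition bounded_ops ::
    "'a::complex_vector hspace \<Rightarrow> 'b::complex_vector hspace \<Rightarrow> ('a \<Rightarrow> 'b) set" where
  "bounded_ops X Y = {T. T \<in> hcarrier X \<rightarrow> hcarrier Y
     \<and> (\<forall>x\<in>hcarrier X. \<forall>y\<in>hcarrier X. T (x + y) = T x + T y)
     \<and> (\<forall>c. \<forall>x\<in>hcarrier X. T (c *\<^sub>C x) = c *\<^sub>C T x)
     \<and> (\<exists>M. \<forall>x\<in>hcarrier X. hnorm Y (T x) \<le> M * hnorm X x)}"

text \<open>Unbounded operators are identified with their graphs, so that \<open>Domain\<close> is the domain and
  \<open>B \<subseteq> C\<close> says that \<open>C\<close> extends \<open>B\<close>.\<close>

definition op_app :: "('a \<times> 'b) set \<Rightarrow> 'a \<Rightarrow> 'b" where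
  "op_app T x = (THE y. (x, y) \<in> T)"

definition graph_on :: "'a set \<Rightarrow> ('a \<Rightarrow> 'b) \<Rightarrow> ('a \<times> 'b) set" where
  "graph_on S f = (\<lambda>x. (x, f x)) ` S"

definition linear_operator ::
    "'a::complex_vector hspace \<Rightarrow> 'b::complex_vector hspace \<Rightarrow> ('a \<times> 'b) set \<Rightarrow> bool" where
  "linear_operator X Y T \<longleftrightarrow>
     T \<subseteq> hcarrier X \<times> hcarrier Y \<and> complex_vector.subspace T \<and> single_valued T"

definition closed_operator ::
    "'a::complex_vector hspace \<Rightarrow> 'b::complex_vector hspace \<Rightarrow> ('a \<times> 'b) set \<Rightarrow> bool" where
  "closed_operator X Y T \<longleftrightarrow> linear_operator X Y T \<and> closedin (htopology (X \<oplus>\<^sub>H Y)) T"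

definition dense_in :: "'a::complex_vector hspace \<Rightarrow> 'a set \<Rightarrow> bool" where
  "dense_in X S \<longleftrightarrow> S \<subseteq> hcarrier X \<and> htopology X closure_of S = hcarrier X"

text \<open>The adjoint of a relation from \<open>X\<close> to \<open>Y\<close>; for a densely defined operator this is the usual
  adjoint operator.\<close>
definition adjoint_rel :: "'a hspace \<Rightarrow> 'b hspace \<Rightarrow> ('a \<times> 'b) set \<Rightarrow> ('b \<times> 'a) set" where
  "adjoint_rel X Y C = {(x, y) \<in> hcarrier Y \<times> hcarrier X.
     \<forall>(u, v)\<in>C. hinner Y v x = hinner X u y}"

definition neg_op :: "('a \<times> 'b::uminus) set \<Rightarrow> ('a \<times> 'b) set" where
  "neg_op T = {(x, - y) | x y. (x, y) \<in> T}"

definition graph_space :: "'a hspace \<Rightarrow> 'b hspace \<Rightarrow> ('a \<times> 'b) set \<Rightarrow> 'a hspace" where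
  "graph_space X Y C = \<lparr>hcarrier = Domain C,
     hinner = (\<lambda>x y. hinner X x y + hinner Y (op_app C x) (op_app C y))\<rparr>"

text \<open>The operator matrix with rows $(0, D)$ and $(G, 0)$.\<close>
definition block_op :: "('b \<times> 'a) set \<Rightarrow> ('a \<times> 'b) set \<Rightarrow> (('a \<times> 'b) \<times> ('a \<times> 'b)) set" where
  "block_op D G = {((u, w), (f, g)) | u w f g. (w, f) \<in> D \<and> (u, g) \<in> G}"

definition monotone_rel :: "'a::complex_vector hspace \<Rightarrow> ('a \<times> 'a) set \<Rightarrow> bool" where
  "monotone_rel Y C \<longleftrightarrow> C \<subseteq> hcarrier Y \<times> hcarrier Y
     \<and> (\<forall>(x, y)\<in>C. \<forall>(u, v)\<in>C. Re (hinner Y (x - u) (y - v)) \<ge> 0)"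

definition maximal_monotone_rel :: "'a::complex_vector hspace \<Rightarrow> ('a \<times> 'a) set \<Rightarrow> bool" where
  "maximal_monotone_rel Y C \<longleftrightarrow> monotone_rel Y C \<and> (\<nexists>C'. monotone_rel Y C' \<and> C \<subset> C')"

definition selfadjoint_rel :: "'a hspace \<Rightarrow> ('a \<times> 'a) set \<Rightarrow> bool" where
  "selfadjoint_rel Y C \<longleftrightarrow> C \<subseteq> hcarrier Y \<times> hcarrier Y \<and> C = adjoint_rel Y Y C"

definition hypothesis ::
    "'e::complex_vector hspace \<Rightarrow> 'h::complex_vector hspace \<Rightarrow> ('e \<times> 'h) set \<Rightarrow> ('e \<times> 'h) set \<Rightarrow>
     'e hspace \<Rightarrow> 'u::complex_vector hspace \<Rightarrow> ('e \<Rightarrow> 'h) \<Rightarrow> ('e \<Rightarrow> 'u) \<Rightarrow> bool" where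
  "hypothesis E H G0 G E0 U L K \<longleftrightarrow>
     dense_in E (hcarrier E0) \<and> continuous_map (htopology E0) (htopology E) id
     \<and> closed_operator E (H \<oplus>\<^sub>H U) (graph_on (hcarrier E0) (\<lambda>u. (L u, K u)))
     \<and> G0 \<subseteq> graph_on (hcarrier E0) L \<and> graph_on (hcarrier E0) L \<subseteq> G
     \<and> (\<forall>u\<in>Domain G0. K u = 0)"

text \<open>Functionals on a space are functions restricted to its carrier.  \<open>dual_op X Y T\<close> is
  $T^{\diamond}$; it takes values in $X'$.\<close>
definition dual_op :: "'a hspace \<Rightarrow> 'b hspace \<Rightarrow> ('a \<Rightarrow> 'b) \<Rightarrow> 'b \<Rightarrow> ('a \<Rightarrow> complex)" where
  "dual_op X Y T w = (\<lambda>x\<in>hcarrier X. hinner Y w (T x))"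

text \<open>The copy of $E$ inside $E_0'$.\<close>
definition embedded_in_dual :: "'a hspace \<Rightarrow> 'a hspace \<Rightarrow> ('a \<Rightarrow> complex) set" where
  "embedded_in_dual E0 E = (\<lambda>e. \<lambda>x\<in>hcarrier E0. hinner E e x) ` hcarrier E"

definition form_domain ::
    "'e hspace \<Rightarrow> 'h hspace \<Rightarrow> 'e hspace \<Rightarrow> 'u hspace \<Rightarrow> ('e \<Rightarrow> 'h) \<Rightarrow> ('e \<Rightarrow> 'u) \<Rightarrow> ('e \<times> 'h) set" where
  "form_domain E H E0 U L K = {(u, w) \<in> hcarrier E0 \<times> hcarrier H.
     (\<lambda>x\<in>hcarrier E0. dual_op E0 U K (K u) x - dual_op E0 H L w x) \<in> embedded_in_dual E0 E}"

definition boundary_space ::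
    "'a hspace \<Rightarrow> 'b hspace \<Rightarrow> ('a \<times> 'b) set \<Rightarrow> ('a \<times> 'b) set \<Rightarrow> 'a hspace" where
  "boundary_space X Y C0 C = orth_compl (graph_space X Y C) (Domain C0)"

definition boundary_proj ::
    "'a::complex_vector hspace \<Rightarrow> 'b hspace \<Rightarrow> ('a \<times> 'b) set \<Rightarrow> ('a \<times> 'b) set \<Rightarrow> 'a \<Rightarrow> 'a" where
  "boundary_proj X Y C0 C =
     orth_proj (graph_space X Y C) (hcarrier (boundary_space X Y C0 C))"

end

theory Submission
  imports Defs
begin

text \<open>
  Let \<open>BD\<close> be the boundary space of \<open>G\<close>.  By the abstract Green formula
  \<open>\<langle>w | G x\<rangle> + \<langle>D w | x\<rangle> = \<langle>D \<pi> w | \<pi> x\<rangle>\<close>, a pair \<open>(u, w)\<close> lies in the form domain if and only if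
  \<open>\<langle>K \<pi> u | K x\<rangle> = \<langle>D \<pi> w | x\<rangle>\<close> for all \<open>x \<in> E\<^sub>0 \<inter> BD\<close>, that is,
  \<open>(\<pi> u, D \<pi> w) \<in> k\<^sup>* k\<close> for the closed operator \<open>k = K\<close> restricted to \<open>E\<^sub>0 \<inter> BD\<close>.  So the theorem
  amounts to the fact that the relations \<open>k\<^sup>* k\<close> with \<open>k\<close> closed are exactly the maximal monotone
  selfadjoint ones.  In one direction, \<open>k\<^sup>* k\<close> is symmetric and monotone, and projecting
  \<open>(f, G f, 0)\<close> onto the graph of \<open>(L, K)\<close> shows that \<open>1 + k\<^sup>* k\<close> is onto.  In the other, \<open>h\<close> is
  factorized by two completions that start from its resolvent and are realized inside the given
  space; no square root is needed.
\<close>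

subsection \<open>Inner products, sequences and projections\<close>

locale semi_inner =
  fixes X :: "'a::complex_vector hspace"
  assumes subspace_hcarrier: "complex_vector.subspace (hcarrier X)"
    and ip_commute:
      "\<And>x y. x \<in> hcarrier X \<Longrightarrow> y \<in> hcarrier X \<Longrightarrow> hinner X x y = cnj (hinner X y x)"
    and ip_add_right:
      "\<And>x y z. x \<in> hcarrier X \<Longrightarrow> y \<in> hcarrier X \<Longrightarrow> z \<in> hcarrier X \<Longrightarrow>
        hinner X x (y + z) = hinner X x y + hinner X x z"
    and ip_scale_right:
      "\<And>c x y. x \<in> hcarrier X \<Longrightarrow> y \<in> hcarrier X \<Longrightarrow> hinner X x (c *\<^sub>C y) = c * hinner X x y"
    and ip_nonneg: "\<And>x. x \<in> hcarrier X \<Longrightarrow> 0 \<le> Re (hinner X x x)"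
begin

lemma zero_mem [simp, intro]: "0 \<in> hcarrier X"
  using subspace_hcarrier by (rule complex_vector.subspace_0)

lemma add_mem [simp, intro]: "x \<in> hcarrier X \<Longrightarrow> y \<in> hcarrier X \<Longrightarrow> x + y \<in> hcarrier X"
  using subspace_hcarrier by (rule complex_vector.subspace_add)

lemma diff_mem [simp, intro]: "x \<in> hcarrier X \<Longrightarrow> y \<in> hcarrier X \<Longrightarrow> x - y \<in> hcarrier X"
  using subspace_hcarrier by (rule complex_vector.subspace_diff)

lemma neg_mem [simp, intro]: "x \<in> hcarrier X \<Longrightarrow> - x \<in> hcarrier X"
  using subspace_hcarrier by (rule complex_vector.subspace_neg)

lemma scale_mem [simp, intro]: "x \<in> hcarrier X \<Longrightarrow> c *\<^sub>C x \<in> hcarrier X"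
  using subspace_hcarrier by (rule complex_vector.subspace_scale)

lemma ip_zero_right: "x \<in> hcarrier X \<Longrightarrow> hinner X x 0 = 0"
  using ip_scale_right[of x x 0] by simp

lemma ip_neg_right: "x \<in> hcarrier X \<Longrightarrow> y \<in> hcarrier X \<Longrightarrow> hinner X x (- y) = - hinner X x y"
  using ip_scale_right[of x y "-1"] by (simp add: scaleC_one)

lemma ip_diff_right:
  assumes "x \<in> hcarrier X" "y \<in> hcarrier X" "z \<in> hcarrier X"
  shows "hinner X x (y - z) = hinner X x y - hinner X x z"
  using assms ip_add_right[of x y "- z"] by (simp add: ip_neg_right)

lemma ip_add_left:
  assumes "x \<in> hcarrier X" "y \<in> hcarrier X" "z \<in> hcarrier X"
  shows "hinner X (x + y) z = hinner X x z + hinner X y z"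
  using assms ip_commute[of "x + y" z] ip_commute[of x z] ip_commute[of y z]
  by (simp add: ip_add_right)

lemma ip_zero_left: "x \<in> hcarrier X \<Longrightarrow> hinner X 0 x = 0"
  using ip_commute[of 0 x] by (simp add: ip_zero_right)

lemma ip_neg_left: "x \<in> hcarrier X \<Longrightarrow> y \<in> hcarrier X \<Longrightarrow> hinner X (- x) y = - hinner X x y"
  using ip_commute[of "-x" y] ip_commute[of x y] by (simp add: ip_neg_right)

lemma ip_diff_left:
  assumes "x \<in> hcarrier X" "y \<in> hcarrier X" "z \<in> hcarrier X"
  shows "hinner X (x - y) z = hinner X x z - hinner X y z"
  using assms ip_add_left[of x "- y" z] by (simp add: ip_neg_left)

lemma ip_scale_left:
  "x \<in> hcarrier X \<Longrightarrow> y \<in> hcarrier X \<Longrightarrow> hinner X (c *\<^sub>C x) y = cnj c * hinner X x y"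
  using ip_commute[of "c *\<^sub>C x" y] ip_commute[of x y] by (simp add: ip_scale_right)

lemmas ip_simps = ip_zero_right ip_neg_right ip_diff_right ip_add_right ip_scale_right
  ip_zero_left ip_neg_left ip_diff_left ip_add_left ip_scale_left

lemma hnorm_nonneg: "x \<in> hcarrier X \<Longrightarrow> 0 \<le> hnorm X x"
  by (simp add: hnorm_def ip_nonneg)

lemma hnorm_power2: "x \<in> hcarrier X \<Longrightarrow> (hnorm X x)\<^sup>2 = Re (hinner X x x)"
  by (simp add: hnorm_def ip_nonneg)

lemma ip_self: "x \<in> hcarrier X \<Longrightarrow> hinner X x x = of_real ((hnorm X x)\<^sup>2)"
  using ip_commute[of x x] by (simp add: hnorm_power2 complex_eq_iff)

lemma hnorm_zero: "hnorm X 0 = 0"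
  by (simp add: hnorm_def ip_simps)

lemma hnorm_scale: "x \<in> hcarrier X \<Longrightarrow> hnorm X (c *\<^sub>C x) = cmod c * hnorm X x"
proof -
  assume x: "x \<in> hcarrier X"
  have "hinner X (c *\<^sub>C x) (c *\<^sub>C x) = of_real ((cmod c)\<^sup>2) * hinner X x x"
    unfolding complex_norm_square using x by (simp add: ip_simps)
  then have "Re (hinner X (c *\<^sub>C x) (c *\<^sub>C x)) = (cmod c)\<^sup>2 * Re (hinner X x x)"
    by simp
  then show ?thesis by (simp add: hnorm_def real_sqrt_mult)
qed

lemma hnorm_neg: "x \<in> hcarrier X \<Longrightarrow> hnorm X (- x) = hnorm X x"
  by (simp add: hnorm_def ip_simps)

lemma hnorm_minus_commute:
  "x \<in> hcarrier X \<Longrightarrow> y \<in> hcarrier X \<Longrightarrow> hnorm X (x - y) = hnorm X (y - x)"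
  using hnorm_neg[of "x - y"] by simp

lemma hnorm_add_power2:
  assumes "x \<in> hcarrier X" "y \<in> hcarrier X"
  shows "(hnorm X (x + y))\<^sup>2 = (hnorm X x)\<^sup>2 + 2 * Re (hinner X x y) + (hnorm X y)\<^sup>2"
  using assms ip_commute[of y x] by (simp add: hnorm_power2 ip_simps)

lemma hnorm_diff_power2:
  assumes "x \<in> hcarrier X" "y \<in> hcarrier X"
  shows "(hnorm X (x - y))\<^sup>2 = (hnorm X x)\<^sup>2 - 2 * Re (hinner X x y) + (hnorm X y)\<^sup>2"
  using hnorm_add_power2[of x "- y"] assms by (simp add: hnorm_neg ip_simps)

lemma cauchy_schwarz:
  assumes x: "x \<in> hcarrier X" and y: "y \<in> hcarrier X"
  shows "cmod (hinner X x y) \<le> hnorm X x * hnorm X y"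
proof -
  define m where "m = cmod (hinner X x y)"
  define c where "c = (if m = 0 then 1 else cnj (hinner X x y) / of_real m)"
  have c1: "cmod c = 1" and cm: "c * hinner X x y = of_real m"
    by (auto simp: c_def m_def norm_divide mult.commute[of "cnj _"] power2_eq_square
        simp flip: complex_norm_square)
  define a b where "a = (hnorm X x)\<^sup>2" and "b = (hnorm X y)\<^sup>2"
  have q: "0 \<le> a - 2 * t * m + t\<^sup>2 * b" for t :: real
  proof -
    have "0 \<le> (hnorm X (x - (of_real t * c) *\<^sub>C y))\<^sup>2" by simp
    also have "\<dots> = a - 2 * Re (of_real t * (c * hinner X x y)) + (hnorm X ((of_real t * c) *\<^sub>C y))\<^sup>2"
      using x y by (simp add: hnorm_diff_power2 ip_simps a_def mult.assoc)
    also have "\<dots> = a - 2 * t * m + t\<^sup>2 * b"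
      unfolding cm using y by (simp add: hnorm_scale norm_mult c1 b_def power_mult_distrib)
    finally show ?thesis .
  qed
  have "m\<^sup>2 \<le> a * b"
  proof (cases "b = 0")
    case True
    have "m = 0"
    proof (rule ccontr)
      assume "m \<noteq> 0"
      then show False using q[of "(a + 1) / (2 * m)"] True by (simp add: a_def)
    qed
    then show ?thesis using True by simp
  next
    case False
    then have "b > 0" by (simp add: b_def)
    then show ?thesis using q[of "m / b"] by (simp add: field_simps power2_eq_square)
  qed
  also have "a * b = (hnorm X x * hnorm X y)\<^sup>2" by (simp add: a_def b_def power_mult_distrib)
  finally show ?thesis
    using x y by (auto simp: m_def hnorm_nonneg intro: power2_le_imp_le)
qed

lemma hnorm_triangle:
  assumes x: "x \<in> hcarrier X" and y: "y \<in> hcarrier X"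
  shows "hnorm X (x + y) \<le> hnorm X x + hnorm X y"
proof (rule power2_le_imp_le)
  have "Re (hinner X x y) \<le> hnorm X x * hnorm X y"
    using cauchy_schwarz[OF x y] complex_Re_le_cmod order_trans by blast
  then show "(hnorm X (x + y))\<^sup>2 \<le> (hnorm X x + hnorm X y)\<^sup>2"
    using x y by (simp add: hnorm_add_power2 power2_sum)
qed (use x y in \<open>simp add: hnorm_nonneg\<close>)

lemma hnorm_triangle_sub:
  assumes "x \<in> hcarrier X" "y \<in> hcarrier X" "z \<in> hcarrier X"
  shows "hnorm X (x - z) \<le> hnorm X (x - y) + hnorm X (y - z)"
  using hnorm_triangle[of "x - y" "y - z"] assms by simp

end

definition hlim :: "'a::complex_vector hspace \<Rightarrow> (nat \<Rightarrow> 'a) \<Rightarrow> 'a \<Rightarrow> bool" where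
  "hlim X s x \<longleftrightarrow> (\<forall>n. s n \<in> hcarrier X) \<and> x \<in> hcarrier X \<and> (\<lambda>n. hnorm X (s n - x)) \<longlonglongrightarrow> 0"

definition hcauchy :: "'a::complex_vector hspace \<Rightarrow> (nat \<Rightarrow> 'a) \<Rightarrow> bool" where
  "hcauchy X s \<longleftrightarrow> (\<forall>n. s n \<in> hcarrier X) \<and>
     (\<forall>e>0. \<exists>N. \<forall>m\<ge>N. \<forall>n\<ge>N. hnorm X (s m - s n) < e)"

lemma hcauchy_mono:
  assumes t: "hcauchy Y t" and s: "\<And>n. s n \<in> hcarrier X"
    and le: "\<And>m n. hnorm X (s m - s n) \<le> hnorm Y (t m - t n)"
  shows "hcauchy X s"
  unfolding hcauchy_def
proof (intro conjI allI impI s)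
  fix e :: real assume "e > 0"
  then obtain N where "\<And>m n. m \<ge> N \<Longrightarrow> n \<ge> N \<Longrightarrow> hnorm Y (t m - t n) < e"
    using t unfolding hcauchy_def by blast
  then show "\<exists>N. \<forall>m\<ge>N. \<forall>n\<ge>N. hnorm X (s m - s n) < e"
    using le order_le_less_trans by blast
qed

lemma tendsto_zero_le:
  fixes f g :: "nat \<Rightarrow> real"
  assumes "g \<longlonglongrightarrow> 0" "\<And>n. 0 \<le> f n" "\<And>n. f n \<le> g n"
  shows "f \<longlonglongrightarrow> 0"
  by (rule tendsto_sandwich[OF _ _ tendsto_const assms(1)]) (use assms in auto)

context semi_inner begin

lemma hlim_const: "x \<in> hcarrier X \<Longrightarrow> hlim X (\<lambda>_. x) x"
  by (simp add: hlim_def hnorm_zero)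

lemma hlim_add:
  assumes "hlim X s x" "hlim X t y"
  shows "hlim X (\<lambda>n. s n + t n) (x + y)"
proof -
  have "(\<lambda>n. hnorm X (s n - x) + hnorm X (t n - y)) \<longlonglongrightarrow> 0"
    using assms by (auto simp: hlim_def intro: tendsto_add_zero)
  then have "(\<lambda>n. hnorm X (s n + t n - (x + y))) \<longlonglongrightarrow> 0"
  proof (rule tendsto_zero_le)
    fix n
    show "hnorm X (s n + t n - (x + y)) \<le> hnorm X (s n - x) + hnorm X (t n - y)"
      using hnorm_triangle[of "s n - x" "t n - y"] assms by (simp add: hlim_def algebra_simps)
  qed (use assms in \<open>auto simp: hlim_def hnorm_nonneg\<close>)
  then show ?thesis using assms by (simp add: hlim_def)
qed

lemma hlim_scale:
  assumes "hlim X s x"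
  shows "hlim X (\<lambda>n. c *\<^sub>C s n) (c *\<^sub>C x)"
proof -
  have "hnorm X (c *\<^sub>C s n - c *\<^sub>C x) = cmod c * hnorm X (s n - x)" for n
    using assms by (simp add: hlim_def hnorm_scale flip: complex_vector.scale_right_diff_distrib)
  moreover have "(\<lambda>n. cmod c * hnorm X (s n - x)) \<longlonglongrightarrow> 0"
    using assms by (auto simp: hlim_def intro: tendsto_mult_right_zero)
  ultimately show ?thesis using assms by (simp add: hlim_def)
qed

lemma hlim_neg: "hlim X s x \<Longrightarrow> hlim X (\<lambda>n. - s n) (- x)"
  using hlim_scale[of s x "-1"] by (simp add: scaleC_one)

lemma hlim_diff:
  assumes "hlim X s x" "hlim X t y"
  shows "hlim X (\<lambda>n. s n - t n) (x - y)"
  using hlim_add[OF assms(1) hlim_neg[OF assms(2)]] by simp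

lemma hlim_ip:
  assumes s: "hlim X s x" and t: "hlim X t y"
  shows "(\<lambda>n. hinner X (s n) (t n)) \<longlonglongrightarrow> hinner X x y"
proof -
  note [simp] = s[unfolded hlim_def, THEN conjunct1, rule_format]
    t[unfolded hlim_def, THEN conjunct1, rule_format]
    s[unfolded hlim_def, THEN conjunct2, THEN conjunct1]
    t[unfolded hlim_def, THEN conjunct2, THEN conjunct1]
  have ls: "(\<lambda>n. hnorm X (s n - x)) \<longlonglongrightarrow> 0" and lt: "(\<lambda>n. hnorm X (t n - y)) \<longlonglongrightarrow> 0"
    using s t by (auto simp: hlim_def)
  have "(\<lambda>n. hnorm X (s n - x) * (hnorm X y + hnorm X (t n - y)) + hnorm X x * hnorm X (t n - y))
      \<longlonglongrightarrow> 0 * (hnorm X y + 0) + hnorm X x * 0"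
    by (intro tendsto_intros ls lt)
  then have "(\<lambda>n. hnorm X (s n - x) * (hnorm X y + hnorm X (t n - y)) + hnorm X x * hnorm X (t n - y))
      \<longlonglongrightarrow> 0" by simp
  then have "(\<lambda>n. cmod (hinner X (s n) (t n) - hinner X x y)) \<longlonglongrightarrow> 0"
  proof (rule tendsto_zero_le[where g = "\<lambda>n. hnorm X (s n - x) * (hnorm X y + hnorm X (t n - y)) + hnorm X x * hnorm X (t n - y)"])
    fix n
    have "cmod (hinner X (s n) (t n) - hinner X x y)
        = cmod (hinner X (s n - x) (t n) + hinner X x (t n - y))"
      by (simp add: ip_simps)
    also have "\<dots> \<le> hnorm X (s n - x) * hnorm X (t n) + hnorm X x * hnorm X (t n - y)"
      by (rule order_trans[OF norm_triangle_ineq]) (intro add_mono cauchy_schwarz; simp)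
    also have "\<dots> \<le> hnorm X (s n - x) * (hnorm X y + hnorm X (t n - y)) + hnorm X x * hnorm X (t n - y)"
      using hnorm_triangle[of y "t n - y"] by (simp add: mult_left_mono hnorm_nonneg)
    finally show "cmod (hinner X (s n) (t n) - hinner X x y)
      \<le> hnorm X (s n - x) * (hnorm X y + hnorm X (t n - y)) + hnorm X x * hnorm X (t n - y)" .
  qed simp_all
  then show ?thesis by (simp add: LIM_zero_iff tendsto_norm_zero_iff)
qed

lemma hlim_hnorm: "hlim X s x \<Longrightarrow> (\<lambda>n. hnorm X (s n)) \<longlonglongrightarrow> hnorm X x"
  unfolding hnorm_def by (intro tendsto_real_sqrt tendsto_Re hlim_ip)

lemma hlim_imp_hcauchy:
  assumes "hlim X s x"
  shows "hcauchy X s"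
  unfolding hcauchy_def
proof (intro conjI allI impI)
  fix e :: real assume "e > 0"
  then have "\<forall>\<^sub>F n in sequentially. hnorm X (s n - x) < e / 2"
    using assms unfolding hlim_def by (intro order_tendstoD) auto
  then obtain N where N: "\<And>n. n \<ge> N \<Longrightarrow> hnorm X (s n - x) < e / 2"
    by (auto simp: eventually_sequentially)
  have "hnorm X (s m - s n) < e" if "m \<ge> N" "n \<ge> N" for m n
    using hnorm_triangle_sub[of "s m" x "s n"] hnorm_minus_commute[of x "s n"] N[OF that(1)] N[OF that(2)] assms
    by (simp add: hlim_def)
  then show "\<exists>N. \<forall>m\<ge>N. \<forall>n\<ge>N. hnorm X (s m - s n) < e" by blast
qed (use assms in \<open>auto simp: hlim_def\<close>)

end

locale inner_space = semi_inner +
  assumes ip_pos: "\<And>x. x \<in> hcarrier X \<Longrightarrow> x \<noteq> 0 \<Longrightarrow> 0 < Re (hinner X x x)"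
begin

lemma hnorm_eq_zero: "x \<in> hcarrier X \<Longrightarrow> hnorm X x = 0 \<longleftrightarrow> x = 0"
  using ip_pos[of x] ip_zero_left[of 0] by (cases "x = 0") (auto simp: hnorm_def)

lemma ip_self_eq_zero: "x \<in> hcarrier X \<Longrightarrow> hinner X x x = 0 \<longleftrightarrow> x = 0"
  using ip_pos[of x] ip_zero_left[of 0] by (cases "x = 0") auto

lemma hlim_unique:
  assumes "hlim X s x" "hlim X s y"
  shows "x = y"
proof -
  have "hlim X (\<lambda>n. s n - s n) (x - y)" by (rule hlim_diff[OF assms])
  then have "hnorm X (0 - (x - y)) = 0"
    by (simp add: hlim_def LIMSEQ_const_iff)
  then show ?thesis using assms hnorm_eq_zero[of "y - x"] by (simp add: hlim_def)
qed

sublocale Metric_space "hcarrier X" "hdist X"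
proof
  fix x y z
  show "0 \<le> hdist X x y" by (simp add: hdist_def hnorm_nonneg)
  show "hdist X x y = hdist X y x" by (auto simp: hdist_def hnorm_minus_commute)
  show "x \<in> hcarrier X \<Longrightarrow> y \<in> hcarrier X \<Longrightarrow> (hdist X x y = 0) = (x = y)"
    by (simp add: hdist_def hnorm_eq_zero)
  show "x \<in> hcarrier X \<Longrightarrow> y \<in> hcarrier X \<Longrightarrow> z \<in> hcarrier X \<Longrightarrow>
      hdist X x z \<le> hdist X x y + hdist X y z"
    by (simp add: hdist_def hnorm_triangle_sub)
qed

lemma limitin_iff_hlim:
  assumes "\<And>n. s n \<in> hcarrier X"
  shows "limitin (htopology X) s x sequentially \<longleftrightarrow> hlim X s x"
proof (cases "x \<in> hcarrier X")
  case True
  then have "norm (hnorm X (s n - x)) = hdist X (s n) x" for n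
    using assms by (simp add: hdist_def hnorm_nonneg)
  then show ?thesis
    unfolding limit_metric_sequentially hlim_def LIMSEQ_iff using True assms by simp
qed (simp add: limit_metric_sequentially hlim_def)

lemma closedin_iff_hlim:
  "closedin (htopology X) S \<longleftrightarrow>
     S \<subseteq> hcarrier X \<and> (\<forall>s x. (\<forall>n. s n \<in> S) \<and> hlim X s x \<longrightarrow> x \<in> S)"
  unfolding metric_closedin_iff_sequentially_closed
proof (cases "S \<subseteq> hcarrier X")
  case True
  then have "range s \<subseteq> S \<and> limitin (htopology X) s x sequentially \<longleftrightarrow> (\<forall>n. s n \<in> S) \<and> hlim X s x" for s x
    using limitin_iff_hlim[of s x] by blast
  then show "(S \<subseteq> hcarrier X \<and> (\<forall>s x. range s \<subseteq> S \<and> limitin (htopology X) s x sequentially \<longrightarrow> x \<in> S)) =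
    (S \<subseteq> hcarrier X \<and> (\<forall>s x. (\<forall>n. s n \<in> S) \<and> hlim X s x \<longrightarrow> x \<in> S))" by simp
qed blast

lemma closedin_hlim:
  "closedin (htopology X) S \<Longrightarrow> (\<And>n. s n \<in> S) \<Longrightarrow> hlim X s x \<Longrightarrow> x \<in> S"
  unfolding closedin_iff_hlim by (elim conjE allE[of _ s] allE[of _ x]) simp

lemma dense_in_iff:
  "dense_in X S \<longleftrightarrow> S \<subseteq> hcarrier X \<and> (\<forall>x\<in>hcarrier X. \<forall>e>0. \<exists>y\<in>S. hnorm X (x - y) < e)"
proof (cases "S \<subseteq> hcarrier X")
  case True
  then have "(\<exists>y\<in>S. y \<in> mball x r) \<longleftrightarrow> (\<exists>y\<in>S. hnorm X (x - y) < r)" if "x \<in> hcarrier X" for x r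
    using that by (intro bex_cong) (auto simp: hdist_def)
  then have "htopology X closure_of S = {x \<in> hcarrier X. \<forall>r>0. \<exists>y\<in>S. hnorm X (x - y) < r}"
    unfolding metric_closure_of by blast
  then show ?thesis unfolding dense_in_def using True by blast
qed (simp add: dense_in_def)

lemma dense_orthogonal_zero:
  assumes S: "dense_in X S" and x: "x \<in> hcarrier X" and orth: "\<And>s. s \<in> S \<Longrightarrow> hinner X s x = 0"
  shows "x = 0"
proof (rule ccontr)
  assume "x \<noteq> 0"
  then have pos: "hnorm X x > 0" using x hnorm_eq_zero[OF x] hnorm_nonneg[OF x] by linarith
  then obtain y where y: "y \<in> S" "hnorm X (x - y) < hnorm X x"
    using S x unfolding dense_in_iff by blast
  then have yX: "y \<in> hcarrier X" using S by (auto simp: dense_in_def)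
  have "(hnorm X x)\<^sup>2 = cmod (hinner X (x - y) x)"
    using x yX orth[OF y(1)] by (simp add: ip_simps ip_self norm_power hnorm_nonneg)
  also have "\<dots> \<le> hnorm X (x - y) * hnorm X x" by (rule cauchy_schwarz) (use x yX in auto)
  also have "\<dots> < hnorm X x * hnorm X x" using y pos by simp
  finally show False by (simp add: power2_eq_square)
qed

lemma MCauchy_iff_hcauchy: "MCauchy s \<longleftrightarrow> hcauchy X s"
proof (cases "\<forall>n. s n \<in> hcarrier X")
  case True
  then show ?thesis
    unfolding MCauchy_def hcauchy_def by (auto simp: hdist_def image_subset_iff)
qed (auto simp: MCauchy_def hcauchy_def image_subset_iff)

lemma hilbert_spaceI:
  assumes "\<And>s. hcauchy X s \<Longrightarrow> \<exists>x. hlim X s x"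
  shows "hilbert_space X"
proof
  show "mcomplete"
    unfolding mcomplete_def MCauchy_iff_hcauchy
  proof (intro allI impI)
    fix s assume s: "hcauchy X s"
    then have "limitin (htopology X) s x sequentially \<longleftrightarrow> hlim X s x" for x
      by (simp add: limitin_iff_hlim hcauchy_def)
    then show "\<exists>x. limitin (htopology X) s x sequentially" using assms[OF s] by simp
  qed
qed (rule subspace_hcarrier ip_commute ip_add_right ip_scale_right ip_pos; assumption)+

end

sublocale hilbert_space \<subseteq> inner_space
proof
  show "0 \<le> Re (hinner X x x)" if "x \<in> hcarrier X" for x
  proof (cases "x = 0")
    case True
    then show ?thesis using hinner_scaleC_right[OF that that, of 0] by simp
  qed (use hinner_pos[OF that] in simp)
qed (rule subspace_carrier hinner_commute hinner_add_right hinner_scaleC_right hinner_pos; assumption)+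

context hilbert_space begin

lemma hcauchy_convergent: "hcauchy X s \<Longrightarrow> \<exists>x. hlim X s x"
proof -
  assume s: "hcauchy X s"
  then have "limitin (htopology X) s x sequentially \<longleftrightarrow> hlim X s x" for x
    by (simp add: limitin_iff_hlim hcauchy_def)
  moreover have "\<exists>x. limitin (htopology X) s x sequentially"
    using complete s unfolding mcomplete_def MCauchy_iff_hcauchy by blast
  ultimately show ?thesis by simp
qed

lemma projection_exists:
  assumes S: "complex_vector.subspace S" "closedin (htopology X) S" and x: "x \<in> hcarrier X"
  obtains p where "p \<in> S" "\<And>s. s \<in> S \<Longrightarrow> hinner X s (x - p) = 0"
proof -
  note S0 = complex_vector.subspace_0[OF S(1)] and Sadd = complex_vector.subspace_add[OF S(1)]
    and Sscale = complex_vector.subspace_scale[OF S(1)]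
  have SX: "s \<in> hcarrier X" if "s \<in> S" for s using S(2) that unfolding closedin_iff_hlim by blast
  define d where "d = (INF s\<in>S. hnorm X (x - s))"
  have bdd: "bdd_below ((\<lambda>s. hnorm X (x - s)) ` S)"
    by (rule bdd_belowI2[of _ 0]) (use x SX in \<open>simp add: hnorm_nonneg\<close>)
  have d_le: "d \<le> hnorm X (x - s)" if "s \<in> S" for s
    unfolding d_def by (rule cINF_lower[OF bdd that])
  have d0: "0 \<le> d" unfolding d_def
    by (rule cINF_greatest) (use S0 x SX in \<open>auto simp: hnorm_nonneg\<close>)
  have "\<exists>s\<in>S. hnorm X (x - s) < d + inverse (Suc n)" for n
    using cInf_lessD[of "(\<lambda>s. hnorm X (x - s)) ` S" "d + inverse (Suc n)"] S0 unfolding d_def by fastforce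
  then obtain s where s: "\<And>n. s n \<in> S" "\<And>n. hnorm X (x - s n) < d + inverse (Suc n)" by metis
  note sX [simp] = SX[OF s(1)]
  note [simp] = x
  have lims: "(\<lambda>n. hnorm X (x - s n)) \<longlonglongrightarrow> d"
  proof (rule tendsto_sandwich[of "\<lambda>_. d" _ _ "\<lambda>n. d + inverse (Suc n)"])
    show "(\<lambda>n. d + inverse (Suc n)) \<longlonglongrightarrow> d"
      using tendsto_add[OF tendsto_const LIMSEQ_inverse_real_of_nat, of d] by simp
  qed (use d_le[OF s(1)] s(2) in \<open>auto intro!: always_eventually less_imp_le\<close>)
  have par: "(hnorm X (s m - s n))\<^sup>2 \<le> 2 * (hnorm X (x - s m))\<^sup>2 + 2 * (hnorm X (x - s n))\<^sup>2 - 4 * d\<^sup>2" for m n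
  proof -
    have "(1/2) *\<^sub>C (s m + s n) \<in> S" by (intro Sscale Sadd s)
    then have "d\<^sup>2 \<le> (hnorm X (x - (1/2) *\<^sub>C (s m + s n)))\<^sup>2" using d_le d0 power_mono by blast
    moreover have "2 *\<^sub>C (x - (1/2) *\<^sub>C (s m + s n)) = (x - s m) + (x - s n)"
      by (simp add: complex_vector.scale_right_diff_distrib scaleC_scaleC scaleC_one
          scaleC_add_left[of 1 1, simplified])
    then have "(hnorm X ((x - s m) + (x - s n)))\<^sup>2 = 4 * (hnorm X (x - (1/2) *\<^sub>C (s m + s n)))\<^sup>2"
      using hnorm_scale[of "x - (1/2) *\<^sub>C (s m + s n)" 2] by (simp add: power_mult_distrib)
    moreover have "s m - s n = (x - s n) - (x - s m)" by simp
    then have "(hnorm X (s m - s n))\<^sup>2 = (hnorm X (x - s n))\<^sup>2 - 2 * Re (hinner X (x - s n) (x - s m)) + (hnorm X (x - s m))\<^sup>2"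
      using hnorm_diff_power2[of "x - s n" "x - s m"] by simp
    moreover have "(hnorm X ((x - s m) + (x - s n)))\<^sup>2 =
       (hnorm X (x - s m))\<^sup>2 + 2 * Re (hinner X (x - s n) (x - s m)) + (hnorm X (x - s n))\<^sup>2"
      using hnorm_add_power2[of "x - s m" "x - s n"] ip_commute[of "x - s m" "x - s n"] by simp
    ultimately show ?thesis by linarith
  qed
  have "hcauchy X s" unfolding hcauchy_def
  proof (intro conjI allI impI)
    fix e :: real assume e: "e > 0"
    have "(\<lambda>n. (hnorm X (x - s n))\<^sup>2) \<longlonglongrightarrow> d\<^sup>2" by (intro tendsto_intros lims)
    then have "\<forall>\<^sub>F n in sequentially. (hnorm X (x - s n))\<^sup>2 < d\<^sup>2 + e\<^sup>2 / 4"
      by (rule order_tendstoD) (use e in simp)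
    then obtain N where N: "\<And>n. n \<ge> N \<Longrightarrow> (hnorm X (x - s n))\<^sup>2 < d\<^sup>2 + e\<^sup>2 / 4"
      by (auto simp: eventually_sequentially)
    have "hnorm X (s m - s n) < e" if "m \<ge> N" "n \<ge> N" for m n
      by (rule power2_less_imp_less) (use par[of m n] N[OF that(1)] N[OF that(2)] e in auto)
    then show "\<exists>N. \<forall>m\<ge>N. \<forall>n\<ge>N. hnorm X (s m - s n) < e" by blast
  qed simp
  then obtain p where p: "hlim X s p" using hcauchy_convergent by blast
  then have pS: "p \<in> S" using closedin_hlim[OF S(2)] s(1) by blast
  then have [simp]: "p \<in> hcarrier X" by (rule SX)
  have "hlim X (\<lambda>n. x - s n) (x - p)" by (intro hlim_diff hlim_const p) simp
  then have dp: "hnorm X (x - p) = d" using LIMSEQ_unique lims hlim_hnorm by blast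
  have "hinner X t (x - p) = 0" if t: "t \<in> S" for t
  proof (rule ccontr)
    assume ne: "hinner X t (x - p) \<noteq> 0"
    note [simp] = SX[OF t]
    define a where "a = hinner X t (x - p)"
    define b where "b = (hnorm X t)\<^sup>2 + 1"
    have b: "b > 0" "(hnorm X t)\<^sup>2 < b" by (auto simp: b_def add_nonneg_pos)
    define c where "c = a / of_real b"
    have "d\<^sup>2 \<le> (hnorm X (x - (p + c *\<^sub>C t)))\<^sup>2"
      by (intro power_mono d0 d_le Sadd Sscale pS t)
    also have "x - (p + c *\<^sub>C t) = (x - p) - c *\<^sub>C t" by simp
    also have "(hnorm X \<dots>)\<^sup>2 = d\<^sup>2 - 2 * Re (hinner X (x - p) (c *\<^sub>C t)) + (cmod c)\<^sup>2 * (hnorm X t)\<^sup>2"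
      by (subst hnorm_diff_power2) (auto simp: dp hnorm_scale power_mult_distrib)
    also have "hinner X (x - p) (c *\<^sub>C t) = c * cnj a"
      unfolding a_def by (subst ip_scale_right) (auto simp: ip_commute[of "x - p" t])
    also have "Re (c * cnj a) = (cmod a)\<^sup>2 / b"
    proof -
      have "c * cnj a = of_real ((cmod a)\<^sup>2 / b)"
        by (simp add: c_def complex_norm_square del: of_real_power)
      then show ?thesis by simp
    qed
    also have "(cmod c)\<^sup>2 * (hnorm X t)\<^sup>2 \<le> (cmod a)\<^sup>2 / b"
    proof -
      have "(cmod c)\<^sup>2 * (hnorm X t)\<^sup>2 = (cmod a)\<^sup>2 / b * ((hnorm X t)\<^sup>2 / b)"
        using b by (simp add: c_def norm_divide power_divide power2_eq_square)
      also have "\<dots> \<le> (cmod a)\<^sup>2 / b * 1"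
        using b by (intro mult_left_mono) auto
      finally show ?thesis by simp
    qed
    finally show False using b ne by (simp add: a_def divide_le_0_iff)
  qed
  then show thesis using that pS by blast
qed

end

subsection \<open>Direct sums, closed operators and adjoints\<close>

lemma fst_scaleC [simp]: "fst (c *\<^sub>C p) = c *\<^sub>C fst p"
  and snd_scaleC [simp]: "snd (c *\<^sub>C p) = c *\<^sub>C snd p"
  by (simp_all add: scaleC_prod_def)

lemma scaleC_Pair [simp]: "c *\<^sub>C (x, y) = (c *\<^sub>C x, c *\<^sub>C y)"
  by (simp add: scaleC_prod_def)

lemma hcarrier_hsum [simp]: "hcarrier (X \<oplus>\<^sub>H Y) = hcarrier X \<times> hcarrier Y"
  by (simp add: hsum_def)

lemma hinner_hsum: "hinner (X \<oplus>\<^sub>H Y) p q = hinner X (fst p) (fst q) + hinner Y (snd p) (snd q)"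
  by (simp add: hsum_def split: prod.split)

lemma semi_inner_hsum:
  assumes "semi_inner X" "semi_inner Y"
  shows "semi_inner (X \<oplus>\<^sub>H Y)"
proof -
  interpret X: semi_inner X by fact
  interpret Y: semi_inner Y by fact
  show ?thesis
  proof
    show "complex_vector.subspace (hcarrier (X \<oplus>\<^sub>H Y))"
      by (rule complex_vector.subspaceI) (auto simp: zero_prod_def)
    show "hinner (X \<oplus>\<^sub>H Y) p q = cnj (hinner (X \<oplus>\<^sub>H Y) q p)"
      if "p \<in> hcarrier (X \<oplus>\<^sub>H Y)" "q \<in> hcarrier (X \<oplus>\<^sub>H Y)" for p q
      using that X.ip_commute[of "fst p" "fst q"] Y.ip_commute[of "snd p" "snd q"]
      by (simp add: hinner_hsum mem_Times_iff)
  qed (auto simp: hinner_hsum mem_Times_iff X.ip_simps Y.ip_simps X.ip_nonneg Y.ip_nonneg algebra_simps)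
qed

lemma hnorm_hsum_power2:
  assumes "semi_inner X" "semi_inner Y" "p \<in> hcarrier (X \<oplus>\<^sub>H Y)"
  shows "(hnorm (X \<oplus>\<^sub>H Y) p)\<^sup>2 = (hnorm X (fst p))\<^sup>2 + (hnorm Y (snd p))\<^sup>2"
  using assms
  by (simp add: semi_inner.hnorm_power2[OF semi_inner_hsum] semi_inner.hnorm_power2 mem_Times_iff hinner_hsum)

lemma hnorm_fst_le:
  assumes "semi_inner X" "semi_inner Y" "p \<in> hcarrier (X \<oplus>\<^sub>H Y)"
  shows "hnorm X (fst p) \<le> hnorm (X \<oplus>\<^sub>H Y) p"
  by (rule power2_le_imp_le)
    (use hnorm_hsum_power2[OF assms] semi_inner.hnorm_nonneg[OF semi_inner_hsum] assms in auto)

lemma hnorm_snd_le: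
  assumes "semi_inner X" "semi_inner Y" "p \<in> hcarrier (X \<oplus>\<^sub>H Y)"
  shows "hnorm Y (snd p) \<le> hnorm (X \<oplus>\<^sub>H Y) p"
  by (rule power2_le_imp_le)
    (use hnorm_hsum_power2[OF assms] semi_inner.hnorm_nonneg[OF semi_inner_hsum] assms in auto)

lemma hlim_hsum_iff:
  assumes X: "semi_inner X" and Y: "semi_inner Y"
  shows "hlim (X \<oplus>\<^sub>H Y) s p \<longleftrightarrow> hlim X (\<lambda>n. fst (s n)) (fst p) \<and> hlim Y (\<lambda>n. snd (s n)) (snd p)"
    (is "?L \<longleftrightarrow> ?R")
proof
  interpret XY: semi_inner "X \<oplus>\<^sub>H Y" by (rule semi_inner_hsum[OF X Y])
  interpret X: semi_inner X by fact
  interpret Y: semi_inner Y by fact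
  {
    assume L: ?L
    then have m: "s n - p \<in> hcarrier (X \<oplus>\<^sub>H Y)" and z: "(\<lambda>n. hnorm (X \<oplus>\<^sub>H Y) (s n - p)) \<longlonglongrightarrow> 0" for n
      unfolding hlim_def by (blast intro: XY.diff_mem)+
    have "(\<lambda>n. hnorm X (fst (s n) - fst p)) \<longlonglongrightarrow> 0"
      by (rule tendsto_zero_le[OF z])
        (use hnorm_fst_le[OF X Y m] m in \<open>auto simp: mem_Times_iff intro!: X.hnorm_nonneg\<close>)
    moreover have "(\<lambda>n. hnorm Y (snd (s n) - snd p)) \<longlonglongrightarrow> 0"
      by (rule tendsto_zero_le[OF z])
        (use hnorm_snd_le[OF X Y m] m in \<open>auto simp: mem_Times_iff intro!: Y.hnorm_nonneg\<close>)
    ultimately show ?R using L by (auto simp: hlim_def mem_Times_iff)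
  }
  assume R: ?R
  then have m: "s n \<in> hcarrier (X \<oplus>\<^sub>H Y)" "p \<in> hcarrier (X \<oplus>\<^sub>H Y)" for n
    by (auto simp: hlim_def mem_Times_iff)
  have "(\<lambda>n. (hnorm X (fst (s n) - fst p))\<^sup>2 + (hnorm Y (snd (s n) - snd p))\<^sup>2) \<longlonglongrightarrow> 0\<^sup>2 + 0\<^sup>2"
    using R unfolding hlim_def by (intro tendsto_intros) auto
  then have "(\<lambda>n. (hnorm (X \<oplus>\<^sub>H Y) (s n - p))\<^sup>2) \<longlonglongrightarrow> 0"
    using m by (subst hnorm_hsum_power2[OF X Y]) (auto simp del: hcarrier_hsum)
  then have "(\<lambda>n. sqrt ((hnorm (X \<oplus>\<^sub>H Y) (s n - p))\<^sup>2)) \<longlonglongrightarrow> sqrt 0"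
    by (intro tendsto_intros)
  moreover have "sqrt ((hnorm (X \<oplus>\<^sub>H Y) (s n - p))\<^sup>2) = hnorm (X \<oplus>\<^sub>H Y) (s n - p)" for n
    by (rule real_sqrt_unique[OF refl XY.hnorm_nonneg]) (rule XY.diff_mem[OF m])
  ultimately show ?L using m by (simp add: hlim_def del: hcarrier_hsum)
qed

lemma hilbert_space_hsum:
  assumes "hilbert_space X" "hilbert_space Y"
  shows "hilbert_space (X \<oplus>\<^sub>H Y)"
proof -
  interpret X: hilbert_space X by fact
  interpret Y: hilbert_space Y by fact
  note semi = X.semi_inner_axioms Y.semi_inner_axioms
  interpret semi_inner "X \<oplus>\<^sub>H Y" by (rule semi_inner_hsum[OF semi])
  interpret inner_space "X \<oplus>\<^sub>H Y"
  proof
    show "0 < Re (hinner (X \<oplus>\<^sub>H Y) p p)" if "p \<in> hcarrier (X \<oplus>\<^sub>H Y)" "p \<noteq> 0" for p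
      using that X.ip_pos[of "fst p"] Y.ip_pos[of "snd p"] X.ip_nonneg[of "fst p"] Y.ip_nonneg[of "snd p"]
      by (cases "fst p = 0") (auto simp: hinner_hsum mem_Times_iff prod_eq_iff add_pos_nonneg add_nonneg_pos)
  qed
  show ?thesis
  proof (rule hilbert_spaceI)
    fix s assume s: "hcauchy (X \<oplus>\<^sub>H Y) s"
    then have m: "s k - s n \<in> hcarrier (X \<oplus>\<^sub>H Y)" "s n \<in> hcarrier (X \<oplus>\<^sub>H Y)" for k n
      by (auto simp: hcauchy_def simp del: hcarrier_hsum)
    have "hcauchy X (\<lambda>n. fst (s n))" "hcauchy Y (\<lambda>n. snd (s n))"
      by (rule hcauchy_mono[OF s]; use hnorm_fst_le[OF semi m(1)] hnorm_snd_le[OF semi m(1)] m(2) in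
            \<open>simp add: mem_Times_iff\<close>)+
    then obtain x y where "hlim X (\<lambda>n. fst (s n)) x" "hlim Y (\<lambda>n. snd (s n)) y"
      using X.hcauchy_convergent Y.hcauchy_convergent by blast
    then have "hlim (X \<oplus>\<^sub>H Y) s (x, y)" by (simp add: hlim_hsum_iff[OF semi])
    then show "\<exists>p. hlim (X \<oplus>\<^sub>H Y) s p" by blast
  qed
qed

lemma hcarrier_orth_compl:
  "hcarrier (orth_compl X S) = {x \<in> hcarrier X. \<forall>s\<in>S. hinner X s x = 0}"
  by (simp add: orth_compl_def)

lemma hinner_orth_compl [simp]: "hinner (orth_compl X S) = hinner X"
  by (simp add: orth_compl_def)

lemma hnorm_orth_compl [simp]: "hnorm (orth_compl X S) = hnorm X"
  by (simp add: hnorm_def fun_eq_iff)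

lemma (in hilbert_space) hilbert_space_orth_compl:
  assumes S: "S \<subseteq> hcarrier X"
  shows "hilbert_space (orth_compl X S)"
proof -
  note [simp] = subsetD[OF S]
  interpret O: semi_inner "orth_compl X S"
  proof
    show "complex_vector.subspace (hcarrier (orth_compl X S))"
      by (rule complex_vector.subspaceI) (auto simp: hcarrier_orth_compl ip_simps)
  qed (auto simp: hcarrier_orth_compl ip_simps ip_nonneg intro: ip_commute)
  interpret O: inner_space "orth_compl X S"
    by standard (simp add: hcarrier_orth_compl ip_pos)
  show ?thesis
  proof (rule O.hilbert_spaceI)
    fix s assume s: "hcauchy (orth_compl X S) s"
    then have "hcauchy X s" by (simp add: hcauchy_def hcarrier_orth_compl)
    then obtain x where x: "hlim X s x" using hcauchy_convergent by blast
    have "hinner X t x = 0" if "t \<in> S" for t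
    proof -
      have "(\<lambda>n. hinner X t (s n)) \<longlonglongrightarrow> hinner X t x" using that by (intro hlim_ip hlim_const x) simp
      moreover have "hinner X t (s n) = 0" for n
        using s that by (simp add: hcauchy_def hcarrier_orth_compl)
      ultimately show ?thesis by (simp add: LIMSEQ_const_iff)
    qed
    then have "hlim (orth_compl X S) s x"
      using x s by (simp add: hlim_def hcauchy_def hcarrier_orth_compl)
    then show "\<exists>x. hlim (orth_compl X S) s x" by blast
  qed
qed

lemma hcarrier_graph_space [simp]: "hcarrier (graph_space X Y T) = Domain T"
  by (simp add: graph_space_def)

lemma hinner_graph_space:
  "hinner (graph_space X Y T) x y = hinner X x y + hinner Y (op_app T x) (op_app T y)"
  by (simp add: graph_space_def)

locale closed_op = X: hilbert_space X + Y: hilbert_space Y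
  for X :: "'a::complex_vector hspace" and Y :: "'b::complex_vector hspace" +
  fixes T :: "('a \<times> 'b) set"
  assumes closed_op: "closed_operator X Y T"
begin

lemma subset_carrier: "T \<subseteq> hcarrier X \<times> hcarrier Y"
  and subspace_T: "complex_vector.subspace T"
  and single_valued_T: "single_valued T"
  and closedin_T: "closedin (htopology (X \<oplus>\<^sub>H Y)) T"
  using closed_op unfolding closed_operator_def linear_operator_def by auto

sublocale XY: hilbert_space "X \<oplus>\<^sub>H Y"
  by (rule hilbert_space_hsum) unfold_locales

lemma app_eq: "(x, y) \<in> T \<Longrightarrow> op_app T x = y"
  using single_valued_T unfolding op_app_def single_valued_def by blast

lemma app_in: "x \<in> Domain T \<Longrightarrow> (x, op_app T x) \<in> T"
  using app_eq by auto

lemma mem_iff: "(x, y) \<in> T \<longleftrightarrow> x \<in> Domain T \<and> op_app T x = y"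
  using app_eq by auto

lemma dom_mem [simp]: "x \<in> Domain T \<Longrightarrow> x \<in> hcarrier X"
  and app_mem [simp]: "x \<in> Domain T \<Longrightarrow> op_app T x \<in> hcarrier Y"
  using app_in subset_carrier by auto

lemma app_zero: "0 \<in> Domain T" "op_app T 0 = 0"
  using complex_vector.subspace_0[OF subspace_T] by (auto simp: mem_iff zero_prod_def)

lemma app_add:
  assumes "x \<in> Domain T" "y \<in> Domain T"
  shows "x + y \<in> Domain T" "op_app T (x + y) = op_app T x + op_app T y"
  using complex_vector.subspace_add[OF subspace_T app_in app_in, OF assms] by (auto simp: mem_iff)

lemma app_diff:
  assumes "x \<in> Domain T" "y \<in> Domain T"
  shows "x - y \<in> Domain T" "op_app T (x - y) = op_app T x - op_app T y"
  using complex_vector.subspace_diff[OF subspace_T app_in app_in, OF assms] by (auto simp: mem_iff)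

lemma app_scale:
  assumes "x \<in> Domain T"
  shows "c *\<^sub>C x \<in> Domain T" "op_app T (c *\<^sub>C x) = c *\<^sub>C op_app T x"
  using complex_vector.subspace_scale[OF subspace_T app_in, OF assms, of c] by (auto simp: mem_iff)

lemma closed_seq:
  assumes "\<And>n. s n \<in> Domain T" "hlim X s x" "hlim Y (\<lambda>n. op_app T (s n)) y"
  shows "x \<in> Domain T" "op_app T x = y"
proof -
  have "hlim (X \<oplus>\<^sub>H Y) (\<lambda>n. (s n, op_app T (s n))) (x, y)"
    using assms by (simp add: hlim_hsum_iff X.semi_inner_axioms Y.semi_inner_axioms)
  then have "(x, y) \<in> T" by (rule XY.closedin_hlim[OF closedin_T app_in[OF assms(1)]])
  then show "x \<in> Domain T" "op_app T x = y" by (auto simp: mem_iff)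
qed

sublocale graph: hilbert_space "graph_space X Y T"
proof -
  interpret S: semi_inner "graph_space X Y T"
  proof
    show "complex_vector.subspace (hcarrier (graph_space X Y T))"
      by (rule complex_vector.subspaceI) (simp_all add: app_zero app_add app_scale del: Domain_iff)
    show "hinner (graph_space X Y T) x y = cnj (hinner (graph_space X Y T) y x)"
      if "x \<in> hcarrier (graph_space X Y T)" "y \<in> hcarrier (graph_space X Y T)" for x y
      using that X.ip_commute[of x y] Y.ip_commute[of "op_app T x" "op_app T y"]
      by (simp add: hinner_graph_space)
  qed (auto simp: hinner_graph_space app_add app_scale X.ip_simps Y.ip_simps X.ip_nonneg Y.ip_nonneg algebra_simps)
  interpret I: inner_space "graph_space X Y T"
  proof
    show "0 < Re (hinner (graph_space X Y T) x x)" if "x \<in> hcarrier (graph_space X Y T)" "x \<noteq> 0" for x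
      using that X.ip_pos[of x] Y.ip_nonneg[of "op_app T x"] by (simp add: hinner_graph_space add_pos_nonneg)
  qed
  have norm_eq: "hnorm (graph_space X Y T) x = hnorm (X \<oplus>\<^sub>H Y) (x, op_app T x)" for x
    by (simp add: hnorm_def hinner_graph_space hinner_hsum)
  show "hilbert_space (graph_space X Y T)"
  proof (rule I.hilbert_spaceI)
    fix s assume s: "hcauchy (graph_space X Y T) s"
    then have sT: "s n \<in> Domain T" for n by (simp add: hcauchy_def)
    define p where "p = (\<lambda>n. (s n, op_app T (s n)))"
    have pT: "p n \<in> T" for n using sT app_in by (simp add: p_def)
    have "hcauchy (X \<oplus>\<^sub>H Y) p"
      by (rule hcauchy_mono[OF s]) (use sT in \<open>auto simp: p_def norm_eq app_diff\<close>)
    then obtain q where q: "hlim (X \<oplus>\<^sub>H Y) p q" using XY.hcauchy_convergent by blast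
    then have "q \<in> T" by (rule XY.closedin_hlim[OF closedin_T pT])
    then obtain x where x: "x \<in> Domain T" "q = (x, op_app T x)" by (cases q) (auto simp: mem_iff)
    have "hlim (graph_space X Y T) s x"
      using q x sT by (simp add: hlim_def norm_eq app_diff p_def)
    then show "\<exists>x. hlim (graph_space X Y T) s x" by blast
  qed
qed

lemma hnorm_graph_power2:
  assumes "x \<in> Domain T"
  shows "(hnorm (graph_space X Y T) x)\<^sup>2 = (hnorm X x)\<^sup>2 + (hnorm Y (op_app T x))\<^sup>2"
  using assms by (simp add: graph.hnorm_power2 X.hnorm_power2 Y.hnorm_power2 hinner_graph_space)

lemma hnorm_le_graph:
  assumes "x \<in> Domain T"
  shows "hnorm X x \<le> hnorm (graph_space X Y T) x" "hnorm Y (op_app T x) \<le> hnorm (graph_space X Y T) x"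
proof -
  have "0 \<le> hnorm (graph_space X Y T) x" using graph.hnorm_nonneg[of x] assms by simp
  then show "hnorm X x \<le> hnorm (graph_space X Y T) x"
    and "hnorm Y (op_app T x) \<le> hnorm (graph_space X Y T) x"
    by (rule power2_le_imp_le[rotated], simp add: hnorm_graph_power2[OF assms])+
qed

lemma hlim_graph_iff:
  assumes "\<And>n. s n \<in> Domain T" "x \<in> Domain T"
  shows "hlim (graph_space X Y T) s x \<longleftrightarrow> hlim X s x \<and> hlim Y (\<lambda>n. op_app T (s n)) (op_app T x)"
proof -
  have "hnorm (graph_space X Y T) x = hnorm (X \<oplus>\<^sub>H Y) (x, op_app T x)" for x
    by (simp add: hnorm_def hinner_graph_space hinner_hsum)
  then have "hlim (graph_space X Y T) s x \<longleftrightarrow> hlim (X \<oplus>\<^sub>H Y) (\<lambda>n. (s n, op_app T (s n))) (x, op_app T x)"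
    using assms by (simp add: hlim_def app_diff)
  then show ?thesis by (simp add: hlim_hsum_iff X.semi_inner_axioms Y.semi_inner_axioms)
qed

end

lemma adjoint_rel_subset: "adjoint_rel X Y C \<subseteq> hcarrier Y \<times> hcarrier X"
  by (auto simp: adjoint_rel_def)

lemma mem_adjoint_rel:
  "(y, x) \<in> adjoint_rel X Y C \<longleftrightarrow>
     y \<in> hcarrier Y \<and> x \<in> hcarrier X \<and> (\<forall>u v. (u, v) \<in> C \<longrightarrow> hinner Y v y = hinner X u x)"
  by (auto simp: adjoint_rel_def)

lemma Domain_neg_op [simp]: "Domain (neg_op C) = Domain C"
  by (auto simp: neg_op_def)

lemma mem_neg_op: "(x, y) \<in> neg_op C \<longleftrightarrow> (x, - y :: 'a::ab_group_add) \<in> C"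
  unfolding neg_op_def by force

lemma neg_op_adjoint_rel:
  assumes "semi_inner X" "semi_inner Y" and C: "C \<subseteq> hcarrier X \<times> hcarrier Y"
  shows "neg_op (adjoint_rel X Y C) = adjoint_rel X Y (neg_op C)"
proof -
  interpret X: semi_inner X by fact
  interpret Y: semi_inner Y by fact
  have "(y, x) \<in> neg_op (adjoint_rel X Y C) \<longleftrightarrow> (y, x) \<in> adjoint_rel X Y (neg_op C)" for x y
  proof (cases "y \<in> hcarrier Y \<and> x \<in> hcarrier X")
    case True
    have "(\<forall>u v. (u, v) \<in> C \<longrightarrow> hinner Y v y = hinner X u (- x)) \<longleftrightarrow>
      (\<forall>u v. (u, v) \<in> C \<longrightarrow> hinner Y (- v) y = hinner X u x)"
      using True C by (intro all_cong1 imp_cong refl) (auto simp: X.ip_simps Y.ip_simps minus_equation_iff)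
    also have "\<dots> \<longleftrightarrow> (\<forall>u v. (u, v) \<in> neg_op C \<longrightarrow> hinner Y v y = hinner X u x)"
    proof (intro iffI allI impI)
      fix u v assume *: "\<forall>u v. (u, v) \<in> C \<longrightarrow> hinner Y (- v) y = hinner X u x" "(u, v) \<in> neg_op C"
      show "hinner Y v y = hinner X u x" using *(1)[rule_format, of u "- v"] *(2) by (simp add: mem_neg_op)
    qed (simp add: mem_neg_op)
    finally show ?thesis using True by (simp add: mem_neg_op mem_adjoint_rel)
  next
    case False
    then show ?thesis using X.neg_mem[of "-x"] by (auto simp: mem_neg_op mem_adjoint_rel)
  qed
  then show ?thesis by auto
qed

lemma subspace_adjoint_rel:
  assumes "semi_inner X" "semi_inner Y" and C: "C \<subseteq> hcarrier X \<times> hcarrier Y"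
  shows "complex_vector.subspace (adjoint_rel X Y C)"
proof -
  interpret X: semi_inner X by fact
  interpret Y: semi_inner Y by fact
  have mem: "u \<in> hcarrier X" "v \<in> hcarrier Y" if "(u, v) \<in> C" for u v using that C by auto
  show ?thesis
    by (rule complex_vector.subspaceI)
      (clarsimp simp: zero_prod_def mem_adjoint_rel, frule mem(1), frule mem(2),
        simp add: X.ip_simps Y.ip_simps)+
qed

lemma closedin_adjoint_rel:
  assumes "hilbert_space X" "hilbert_space Y" and C: "C \<subseteq> hcarrier X \<times> hcarrier Y"
  shows "closedin (htopology (Y \<oplus>\<^sub>H X)) (adjoint_rel X Y C)"
proof -
  interpret X: hilbert_space X by fact
  interpret Y: hilbert_space Y by fact
  interpret YX: hilbert_space "Y \<oplus>\<^sub>H X" by (rule hilbert_space_hsum) fact+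
  show ?thesis
    unfolding YX.closedin_iff_hlim
  proof (intro conjI allI impI)
    show "adjoint_rel X Y C \<subseteq> hcarrier (Y \<oplus>\<^sub>H X)" using adjoint_rel_subset[of X Y C] by simp
    fix s p assume *: "(\<forall>n. s n \<in> adjoint_rel X Y C) \<and> hlim (Y \<oplus>\<^sub>H X) s p"
    then have lim: "hlim Y (\<lambda>n. fst (s n)) (fst p)" "hlim X (\<lambda>n. snd (s n)) (snd p)"
      by (simp_all add: hlim_hsum_iff[OF Y.semi_inner_axioms X.semi_inner_axioms])
    have "hinner Y v (fst p) = hinner X u (snd p)" if uv: "(u, v) \<in> C" for u v
    proof (rule LIMSEQ_unique)
      have mem: "u \<in> hcarrier X" "v \<in> hcarrier Y" using C uv by auto
      show "(\<lambda>n. hinner Y v (fst (s n))) \<longlonglongrightarrow> hinner Y v (fst p)"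
        by (intro Y.hlim_ip Y.hlim_const lim mem)
      have "hinner Y v (fst (s n)) = hinner X u (snd (s n))" for n
        using * uv mem_adjoint_rel[of "fst (s n)" "snd (s n)" X Y C] by simp
      then show "(\<lambda>n. hinner Y v (fst (s n))) \<longlonglongrightarrow> hinner X u (snd p)"
        by (simp add: X.hlim_ip X.hlim_const lim mem)
    qed
    then show "p \<in> adjoint_rel X Y C"
      using lim mem_adjoint_rel[of "fst p" "snd p" X Y C] by (simp add: hlim_def)
  qed
qed

lemma closed_operator_adjoint_rel:
  assumes "hilbert_space X" "hilbert_space Y" and C: "C \<subseteq> hcarrier X \<times> hcarrier Y"
    and dense: "dense_in X (Domain C)"
  shows "closed_operator Y X (adjoint_rel X Y C)"
  unfolding closed_operator_def linear_operator_def
proof (intro conjI)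
  interpret X: hilbert_space X by fact
  interpret Y: hilbert_space Y by fact
  show "adjoint_rel X Y C \<subseteq> hcarrier Y \<times> hcarrier X" by (rule adjoint_rel_subset)
  show "complex_vector.subspace (adjoint_rel X Y C)"
    using C by (intro subspace_adjoint_rel) unfold_locales
  show "closedin (htopology (Y \<oplus>\<^sub>H X)) (adjoint_rel X Y C)" by (rule closedin_adjoint_rel) fact+
  show "single_valued (adjoint_rel X Y C)"
  proof (rule single_valuedI)
    fix y x x' assume *: "(y, x) \<in> adjoint_rel X Y C" "(y, x') \<in> adjoint_rel X Y C"
    have "x - x' = 0"
    proof (rule X.dense_orthogonal_zero[OF dense])
      fix u assume "u \<in> Domain C"
      then obtain v where uv: "(u, v) \<in> C" by blast
      then have "hinner X u x = hinner X u x'" using * unfolding mem_adjoint_rel by metis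
      then show "hinner X u (x - x') = 0" using * uv C by (auto simp: mem_adjoint_rel X.ip_simps)
    qed (use * in \<open>simp add: mem_adjoint_rel\<close>)
    then show "x = x'" by simp
  qed
qed

subsection \<open>Completions inside a Hilbert space\<close>

context semi_inner begin

lemma hcauchy_mem: "hcauchy X s \<Longrightarrow> s n \<in> hcarrier X"
  by (simp add: hcauchy_def)

lemma hcauchyE:
  assumes "hcauchy X s" "e > 0"
  obtains N where "\<And>m n. m \<ge> N \<Longrightarrow> n \<ge> N \<Longrightarrow> hnorm X (s m - s n) < e"
  using assms unfolding hcauchy_def by blast

lemma hcauchy_const: "x \<in> hcarrier X \<Longrightarrow> hcauchy X (\<lambda>_. x)"
  by (simp add: hcauchy_def hnorm_zero)

lemma hcauchy_add:
  assumes s: "hcauchy X s" and t: "hcauchy X t"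
  shows "hcauchy X (\<lambda>n. s n + t n)"
  unfolding hcauchy_def
proof (intro conjI allI impI)
  note [simp] = hcauchy_mem[OF s] hcauchy_mem[OF t]
  show "s n + t n \<in> hcarrier X" for n by simp
  fix e :: real assume "e > 0"
  then have "e / 2 > 0" by simp
  obtain N where N: "\<And>m n. m \<ge> N \<Longrightarrow> n \<ge> N \<Longrightarrow> hnorm X (s m - s n) < e / 2"
    by (rule hcauchyE[OF s \<open>e / 2 > 0\<close>]) blast
  obtain K where K: "\<And>m n. m \<ge> K \<Longrightarrow> n \<ge> K \<Longrightarrow> hnorm X (t m - t n) < e / 2"
    by (rule hcauchyE[OF t \<open>e / 2 > 0\<close>]) blast
  have "hnorm X (s m + t m - (s n + t n)) < e" if "m \<ge> max N K" "n \<ge> max N K" for m n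
    using hnorm_triangle[of "s m - s n" "t m - t n"] N[of m n] K[of m n] that
    by (simp add: algebra_simps)
  then show "\<exists>N. \<forall>m\<ge>N. \<forall>n\<ge>N. hnorm X (s m + t m - (s n + t n)) < e" by blast
qed

lemma hcauchy_scale:
  assumes s: "hcauchy X s"
  shows "hcauchy X (\<lambda>n. c *\<^sub>C s n)"
  unfolding hcauchy_def
proof (intro conjI allI impI)
  note [simp] = hcauchy_mem[OF s]
  show "c *\<^sub>C s n \<in> hcarrier X" for n by simp
  fix e :: real assume "e > 0"
  then have "e / (cmod c + 1) > 0" by (simp add: add_nonneg_pos)
  then obtain N where N: "\<And>m n. m \<ge> N \<Longrightarrow> n \<ge> N \<Longrightarrow> hnorm X (s m - s n) < e / (cmod c + 1)"
    by (rule hcauchyE[OF s]) blast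
  have "hnorm X (c *\<^sub>C s m - c *\<^sub>C s n) < e" if "m \<ge> N" "n \<ge> N" for m n
  proof -
    have "hnorm X (c *\<^sub>C s m - c *\<^sub>C s n) = cmod c * hnorm X (s m - s n)"
      by (simp add: hnorm_scale flip: complex_vector.scale_right_diff_distrib)
    also have "\<dots> \<le> (cmod c + 1) * hnorm X (s m - s n)"
      by (simp add: mult_right_mono hnorm_nonneg)
    also have "\<dots> < (cmod c + 1) * (e / (cmod c + 1))"
      using N[OF that] by (intro mult_strict_left_mono) (auto simp: add_nonneg_pos)
    also have "\<dots> = e" by (simp add: add_nonneg_eq_0_iff)
    finally show ?thesis .
  qed
  then show "\<exists>N. \<forall>m\<ge>N. \<forall>n\<ge>N. hnorm X (c *\<^sub>C s m - c *\<^sub>C s n) < e" by blast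
qed

lemma hcauchy_diff:
  assumes s: "hcauchy X s" and t: "hcauchy X t"
  shows "hcauchy X (\<lambda>n. s n - t n)"
  using hcauchy_add[OF s hcauchy_scale[OF t, of "-1"]] by (simp add: scaleC_one)

lemma hcauchy_bounded:
  assumes s: "hcauchy X s"
  obtains B where "B > 0" "\<And>n. hnorm X (s n) \<le> B"
proof -
  note [simp] = hcauchy_mem[OF s]
  obtain N where N: "\<And>m n. m \<ge> N \<Longrightarrow> n \<ge> N \<Longrightarrow> hnorm X (s m - s n) < 1"
    by (rule hcauchyE[OF s zero_less_one]) blast
  define B where "B = (\<Sum>i\<le>N. hnorm X (s i)) + 1"
  have B: "hnorm X (s n) \<le> B - 1" if "n \<le> N" for n
    using member_le_sum[of n "{..N}" "\<lambda>i. hnorm X (s i)"] that by (simp add: B_def hnorm_nonneg)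
  have "hnorm X (s n) \<le> B" for n
  proof (cases "n \<le> N")
    case False
    then show ?thesis using N[of n N] hnorm_triangle[of "s n - s N" "s N"] B[of N] by simp
  qed (use B[of n] in simp)
  moreover have "B > 0" using B[of 0] hnorm_nonneg[of "s 0"] by simp
  ultimately show thesis using that by blast
qed

lemma ip_null_sequence:
  assumes s: "\<And>n. s n \<in> hcarrier X" "(\<lambda>n. hnorm X (s n)) \<longlonglongrightarrow> 0" and t: "hcauchy X t"
  shows "(\<lambda>n. hinner X (s n) (t n)) \<longlonglongrightarrow> 0"
proof -
  obtain B where B: "B > 0" "\<And>n. hnorm X (t n) \<le> B" using hcauchy_bounded[OF t] by blast
  have "(\<lambda>n. hnorm X (s n) * B) \<longlonglongrightarrow> 0" using s(2) by (intro tendsto_mult_left_zero)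
  then have "(\<lambda>n. cmod (hinner X (s n) (t n))) \<longlonglongrightarrow> 0"
  proof (rule tendsto_zero_le)
    fix n
    show "cmod (hinner X (s n) (t n)) \<le> hnorm X (s n) * B"
      using cauchy_schwarz[OF s(1) hcauchy_mem[OF t]] mult_left_mono[OF B(2) hnorm_nonneg[OF s(1)]]
      by (rule order_trans)
  qed simp
  then show ?thesis by (rule tendsto_norm_zero_cancel)
qed

lemma hcauchy_ip_convergent:
  assumes s: "hcauchy X s" and t: "hcauchy X t"
  shows "convergent (\<lambda>n. hinner X (s n) (t n))"
proof -
  note [simp] = hcauchy_mem[OF s] hcauchy_mem[OF t]
  obtain B where B: "B > 0" "\<And>n. hnorm X (s n) \<le> B" using hcauchy_bounded[OF s] by blast
  obtain C where C: "C > 0" "\<And>n. hnorm X (t n) \<le> C" using hcauchy_bounded[OF t] by blast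
  have "Cauchy (\<lambda>n. hinner X (s n) (t n))"
  proof (rule CauchyI)
    fix e :: real assume e: "e > 0"
    obtain N where N: "\<And>m n. m \<ge> N \<Longrightarrow> n \<ge> N \<Longrightarrow> hnorm X (s m - s n) < e / 2 / C"
      using hcauchyE[OF s, of "e / 2 / C"] e C(1) by auto
    obtain K where K: "\<And>m n. m \<ge> K \<Longrightarrow> n \<ge> K \<Longrightarrow> hnorm X (t m - t n) < e / 2 / B"
      using hcauchyE[OF t, of "e / 2 / B"] e B(1) by auto
    have "cmod (hinner X (s m) (t m) - hinner X (s n) (t n)) < e"
      if "m \<ge> max N K" "n \<ge> max N K" for m n
    proof -
      have "cmod (hinner X (s m) (t m) - hinner X (s n) (t n))
          = cmod (hinner X (s m - s n) (t m) + hinner X (s n) (t m - t n))"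
        by (simp add: ip_simps)
      also have "\<dots> \<le> hnorm X (s m - s n) * hnorm X (t m) + hnorm X (s n) * hnorm X (t m - t n)"
        by (rule order_trans[OF norm_triangle_ineq]) (intro add_mono cauchy_schwarz; simp)
      also have "\<dots> \<le> hnorm X (s m - s n) * C + B * hnorm X (t m - t n)"
        using B C by (intro add_mono mult_left_mono mult_right_mono) (auto simp: hnorm_nonneg)
      also have "\<dots> < e / 2 / C * C + B * (e / 2 / B)"
        using N[of m n] K[of m n] that B C
        by (intro add_strict_mono mult_strict_left_mono mult_strict_right_mono) auto
      finally show ?thesis using B C by simp
    qed
    then show "\<exists>M. \<forall>m\<ge>M. \<forall>n\<ge>M. cmod (hinner X (s m) (t m) - hinner X (s n) (t n)) < e" by blast
  qed
  then show ?thesis by (rule Cauchy_convergent)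
qed

end

locale closable_map = V: semi_inner V + X: hilbert_space X
  for V :: "'v::complex_vector hspace" and X :: "'x::complex_vector hspace" +
  fixes \<tau> :: "'v \<Rightarrow> 'x"
  assumes map_mem [simp]: "\<And>v. v \<in> hcarrier V \<Longrightarrow> \<tau> v \<in> hcarrier X"
    and map_add: "\<And>v w. v \<in> hcarrier V \<Longrightarrow> w \<in> hcarrier V \<Longrightarrow> \<tau> (v + w) = \<tau> v + \<tau> w"
    and map_scale: "\<And>c v. v \<in> hcarrier V \<Longrightarrow> \<tau> (c *\<^sub>C v) = c *\<^sub>C \<tau> v"
    and map_contractive: "\<And>v. v \<in> hcarrier V \<Longrightarrow> hnorm X (\<tau> v) \<le> hnorm V v"
    and map_closable: "\<And>v. v \<in> hcarrier V \<Longrightarrow>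
      \<exists>C. \<forall>w\<in>hcarrier V. cmod (hinner V v w) \<le> C * hnorm X (\<tau> w)"
begin

definition approx :: "(nat \<Rightarrow> 'v) \<Rightarrow> 'x \<Rightarrow> bool" where
  "approx s y \<longleftrightarrow> hcauchy V s \<and> hlim X (\<lambda>n. \<tau> (s n)) y"

definition completion :: "'x hspace" where
  "completion = \<lparr>hcarrier = {y. \<exists>s. approx s y},
     hinner = (\<lambda>y z. lim (\<lambda>n. hinner V ((SOME s. approx s y) n) ((SOME s. approx s z) n)))\<rparr>"

lemma mem_completion: "y \<in> hcarrier completion \<longleftrightarrow> (\<exists>s. approx s y)"
  by (simp add: completion_def)

lemma approx_mem: "approx s y \<Longrightarrow> s n \<in> hcarrier V"
  by (simp add: approx_def V.hcauchy_mem)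

lemma approx_const: "v \<in> hcarrier V \<Longrightarrow> approx (\<lambda>_. v) (\<tau> v)"
  by (simp add: approx_def V.hcauchy_const X.hlim_const)

lemma approx_add:
  assumes "approx s y" "approx t z"
  shows "approx (\<lambda>n. s n + t n) (y + z)"
  using assms X.hlim_add[of "\<lambda>n. \<tau> (s n)" y "\<lambda>n. \<tau> (t n)" z]
  by (auto simp: approx_def V.hcauchy_add map_add V.hcauchy_mem)

lemma approx_scale:
  assumes "approx s y"
  shows "approx (\<lambda>n. c *\<^sub>C s n) (c *\<^sub>C y)"
  using assms X.hlim_scale[of "\<lambda>n. \<tau> (s n)" y c]
  by (auto simp: approx_def V.hcauchy_scale map_scale V.hcauchy_mem)

lemma approx_diff:
  assumes "approx s y" "approx t z"
  shows "approx (\<lambda>n. s n - t n) (y - z)"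
  using approx_add[OF assms(1) approx_scale[OF assms(2), of "-1"]] by (simp add: scaleC_one)

lemma approx_null:
  assumes "approx s 0"
  shows "(\<lambda>n. hnorm V (s n)) \<longlonglongrightarrow> 0"
proof -
  have s: "hcauchy V s" and lim: "hlim X (\<lambda>n. \<tau> (s n)) 0" using assms by (auto simp: approx_def)
  note [simp] = V.hcauchy_mem[OF s]
  obtain B where B: "B > 0" "\<And>n. hnorm V (s n) \<le> B" using V.hcauchy_bounded[OF s] by blast
  have "(\<lambda>n. (hnorm V (s n))\<^sup>2) \<longlonglongrightarrow> 0"
  proof (rule LIMSEQ_I)
    fix e :: real assume e: "e > 0"
    obtain N where N: "\<And>m n. m \<ge> N \<Longrightarrow> n \<ge> N \<Longrightarrow> hnorm V (s m - s n) < e / 2 / B"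
      using V.hcauchyE[OF s, of "e / 2 / B"] e B(1) by auto
    obtain C where C: "\<And>w. w \<in> hcarrier V \<Longrightarrow> cmod (hinner V (s N) w) \<le> C * hnorm X (\<tau> w)"
      using map_closable[of "s N"] by auto
    have "(\<lambda>n. hnorm X (\<tau> (s n))) \<longlonglongrightarrow> 0" using lim by (simp add: hlim_def)
    then have "(\<lambda>n. C * hnorm X (\<tau> (s n))) \<longlonglongrightarrow> 0" by (rule tendsto_mult_right_zero)
    then have "\<forall>\<^sub>F n in sequentially. C * hnorm X (\<tau> (s n)) < e / 2"
      by (rule order_tendstoD) (use e in simp)
    then obtain K where K: "\<And>n. n \<ge> K \<Longrightarrow> C * hnorm X (\<tau> (s n)) < e / 2"
      by (auto simp: eventually_sequentially)
    have "(hnorm V (s n))\<^sup>2 < e" if n: "n \<ge> max N K" for n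
    proof -
      have "(hnorm V (s n))\<^sup>2 = cmod (hinner V (s n - s N) (s n) + hinner V (s N) (s n))"
        by (simp add: V.ip_simps V.ip_self norm_power V.hnorm_nonneg)
      also have "\<dots> \<le> hnorm V (s n - s N) * hnorm V (s n) + C * hnorm X (\<tau> (s n))"
        by (rule order_trans[OF norm_triangle_ineq]) (intro add_mono V.cauchy_schwarz C; simp)
      also have "\<dots> \<le> hnorm V (s n - s N) * B + C * hnorm X (\<tau> (s n))"
        using B by (intro add_right_mono mult_left_mono) (auto simp: V.hnorm_nonneg)
      also have "\<dots> < e / 2 / B * B + e / 2"
        using N[of n N] K[of n] n B by (intro add_strict_mono mult_strict_right_mono) auto
      finally show ?thesis using B by simp
    qed
    then show "\<exists>no. \<forall>n\<ge>no. norm ((hnorm V (s n))\<^sup>2 - 0) < e"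
      by (intro exI[of _ "max N K"]) simp
  qed
  then have "(\<lambda>n. sqrt ((hnorm V (s n))\<^sup>2)) \<longlonglongrightarrow> sqrt 0" by (rule tendsto_real_sqrt)
  then show ?thesis by (simp add: V.hnorm_nonneg)
qed

lemma approx_ip:
  assumes s: "approx s y" and t: "approx t z"
  shows "(\<lambda>n. hinner V (s n) (t n)) \<longlonglongrightarrow> hinner completion y z"
proof -
  define s' t' where "s' = (SOME s. approx s y)" and "t' = (SOME t. approx t z)"
  have s': "approx s' y" and t': "approx t' z"
    using someI[of "\<lambda>s. approx s y", OF s] someI[of "\<lambda>t. approx t z", OF t]
    by (simp_all add: s'_def t'_def)
  note [simp] = approx_mem[OF s] approx_mem[OF t] approx_mem[OF s'] approx_mem[OF t']
  have cs: "hcauchy V s'" "hcauchy V t" "hcauchy V t'"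
    using s' t t' by (auto simp: approx_def)
  have nulls: "(\<lambda>n. hnorm V (s n - s' n)) \<longlonglongrightarrow> 0" "(\<lambda>n. hnorm V (t n - t' n)) \<longlonglongrightarrow> 0"
    using approx_diff[OF s s'] approx_diff[OF t t'] by (simp_all add: approx_null)
  have "(\<lambda>n. hinner V (s n - s' n) (t n)) \<longlonglongrightarrow> 0"
    by (rule V.ip_null_sequence[OF _ nulls(1) cs(2)]) simp
  moreover have "(\<lambda>n. cnj (hinner V (t n - t' n) (s' n))) \<longlonglongrightarrow> cnj 0"
    by (intro tendsto_intros V.ip_null_sequence[OF _ nulls(2) cs(1)]) simp
  moreover have "(\<lambda>n. hinner V (s' n) (t' n)) \<longlonglongrightarrow> hinner completion y z"
    using V.hcauchy_ip_convergent[OF cs(1,3)]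
    by (simp add: completion_def s'_def t'_def convergent_LIMSEQ_iff)
  ultimately have "(\<lambda>n. hinner V (s n - s' n) (t n) + cnj (hinner V (t n - t' n) (s' n))
      + hinner V (s' n) (t' n)) \<longlonglongrightarrow> 0 + cnj 0 + hinner completion y z"
    by (intro tendsto_add)
  moreover have "hinner V (s n - s' n) (t n) + cnj (hinner V (t n - t' n) (s' n))
      + hinner V (s' n) (t' n) = hinner V (s n) (t n)" for n
    using V.ip_commute[of "s' n" "t n - t' n"] by (simp add: V.ip_simps flip: V.ip_commute)
  ultimately show ?thesis by simp
qed

lemma approx_hnorm: "approx s y \<Longrightarrow> (\<lambda>n. hnorm V (s n)) \<longlonglongrightarrow> hnorm completion y"
  unfolding hnorm_def by (intro tendsto_real_sqrt tendsto_Re approx_ip)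

lemma completion_subset: "y \<in> hcarrier completion \<Longrightarrow> y \<in> hcarrier X"
  by (auto simp: mem_completion approx_def hlim_def)

lemma hnorm_le_completion:
  assumes "y \<in> hcarrier completion"
  shows "hnorm X y \<le> hnorm completion y"
proof -
  obtain s where s: "approx s y" using assms mem_completion by blast
  show ?thesis
  proof (rule LIMSEQ_le)
    show "(\<lambda>n. hnorm X (\<tau> (s n))) \<longlonglongrightarrow> hnorm X y" using s by (auto simp: approx_def intro: X.hlim_hnorm)
    show "(\<lambda>n. hnorm V (s n)) \<longlonglongrightarrow> hnorm completion y" using s by (rule approx_hnorm)
    show "\<exists>N. \<forall>n\<ge>N. hnorm X (\<tau> (s n)) \<le> hnorm V (s n)" using map_contractive approx_mem[OF s] by blast
  qed
qed

lemma map_in_completion [simp]: "v \<in> hcarrier V \<Longrightarrow> \<tau> v \<in> hcarrier completion"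
  using approx_const mem_completion by blast

lemma completion_ip_map:
  assumes "v \<in> hcarrier V" "w \<in> hcarrier V"
  shows "hinner completion (\<tau> v) (\<tau> w) = hinner V v w"
  using approx_ip[OF approx_const[OF assms(1)] approx_const[OF assms(2)]]
  by (simp add: LIMSEQ_const_iff)

sublocale completion: inner_space completion
proof
  show "complex_vector.subspace (hcarrier completion)"
  proof (rule complex_vector.subspaceI)
    show "0 \<in> hcarrier completion" using approx_const[OF V.zero_mem] map_scale[OF V.zero_mem, of 0]
      by (auto simp: mem_completion)
  qed (auto simp: mem_completion intro: approx_add approx_scale)
  fix y assume "y \<in> hcarrier completion"
  then obtain s where s: "approx s y" using mem_completion by blast
  note [simp] = approx_mem[OF s]
  show "0 \<le> Re (hinner completion y y)"
    by (rule LIMSEQ_le_const[OF tendsto_Re[OF approx_ip[OF s s]]]) (simp add: V.ip_nonneg)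
  fix z assume "z \<in> hcarrier completion"
  then obtain t where t: "approx t z" using mem_completion by blast
  note [simp] = approx_mem[OF t]
  have "(\<lambda>n. cnj (hinner V (t n) (s n))) \<longlonglongrightarrow> cnj (hinner completion z y)"
    by (intro tendsto_intros approx_ip s t)
  then have "(\<lambda>n. hinner V (s n) (t n)) \<longlonglongrightarrow> cnj (hinner completion z y)"
    by (simp flip: V.ip_commute)
  then show "hinner completion y z = cnj (hinner completion z y)"
    using approx_ip[OF s t] LIMSEQ_unique by blast
  show "hinner completion y (c *\<^sub>C z) = c * hinner completion y z" for c
  proof (rule LIMSEQ_unique)
    show "(\<lambda>n. hinner V (s n) (c *\<^sub>C t n)) \<longlonglongrightarrow> hinner completion y (c *\<^sub>C z)"
      by (intro approx_ip approx_scale s t)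
    show "(\<lambda>n. hinner V (s n) (c *\<^sub>C t n)) \<longlonglongrightarrow> c * hinner completion y z"
      by (simp add: V.ip_simps tendsto_mult_left approx_ip s t)
  qed
  fix x assume "x \<in> hcarrier completion"
  then obtain r where r: "approx r x" using mem_completion by blast
  note [simp] = approx_mem[OF r]
  show "hinner completion y (z + x) = hinner completion y z + hinner completion y x"
  proof (rule LIMSEQ_unique)
    show "(\<lambda>n. hinner V (s n) (t n + r n)) \<longlonglongrightarrow> hinner completion y (z + x)"
      by (intro approx_ip approx_add s t r)
    show "(\<lambda>n. hinner V (s n) (t n + r n)) \<longlonglongrightarrow> hinner completion y z + hinner completion y x"
      by (simp add: V.ip_simps tendsto_add approx_ip s t r)
  qed
next
  fix y assume y: "y \<in> hcarrier completion" "y \<noteq> 0"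
  then have "0 < hnorm X y"
    using X.hnorm_eq_zero[of y] X.hnorm_nonneg[of y] completion_subset by fastforce
  also have "\<dots> \<le> hnorm completion y" using y(1) by (rule hnorm_le_completion)
  finally show "0 < Re (hinner completion y y)" by (simp add: hnorm_def)
qed

lemma approx_hlim:
  assumes s: "approx s y"
  shows "hlim completion (\<lambda>n. \<tau> (s n)) y"
proof -
  note [simp] = approx_mem[OF s]
  have y: "y \<in> hcarrier completion" using s mem_completion by blast
  have "(\<lambda>m. hnorm completion (\<tau> (s m) - y)) \<longlonglongrightarrow> 0"
  proof (rule LIMSEQ_I)
    fix e :: real assume e: "e > 0"
    obtain N where N: "\<And>m n. m \<ge> N \<Longrightarrow> n \<ge> N \<Longrightarrow> hnorm V (s m - s n) < e / 2"
      using V.hcauchyE[of s "e / 2"] s e by (auto simp: approx_def)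
    have "norm (hnorm completion (\<tau> (s m) - y) - 0) < e" if m: "m \<ge> N" for m
    proof -
      have "(\<lambda>n. hnorm V (s m - s n)) \<longlonglongrightarrow> hnorm completion (\<tau> (s m) - y)"
        by (intro approx_hnorm approx_diff approx_const s) simp
      then have "hnorm completion (\<tau> (s m) - y) \<le> e / 2"
        by (rule LIMSEQ_le_const2) (use N[OF m] less_imp_le in blast)
      then show ?thesis using completion.hnorm_nonneg[of "\<tau> (s m) - y"] y e by simp
    qed
    then show "\<exists>no. \<forall>m\<ge>no. norm (hnorm completion (\<tau> (s m) - y) - 0) < e" by blast
  qed
  then show ?thesis using y by (simp add: hlim_def)
qed

lemma map_dense:
  assumes y: "y \<in> hcarrier completion" and e: "e > 0"
  obtains v where "v \<in> hcarrier V" "hnorm completion (y - \<tau> v) < e"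
proof -
  obtain s where s: "approx s y" using y mem_completion by blast
  have "\<forall>\<^sub>F n in sequentially. hnorm completion (\<tau> (s n) - y) < e"
    using approx_hlim[OF s] e unfolding hlim_def by (intro order_tendstoD) auto
  then obtain n where "hnorm completion (\<tau> (s n) - y) < e" by (auto simp: eventually_sequentially)
  then show thesis
    using that[of "s n"] approx_mem[OF s] y by (simp add: completion.hnorm_minus_commute)
qed

lemma hilbert_space_completion: "hilbert_space completion"
proof (rule completion.hilbert_spaceI)
  fix y assume y: "hcauchy completion y"
  note ymem [simp] = completion.hcauchy_mem[OF y]
  have "\<exists>v. v \<in> hcarrier V \<and> hnorm completion (y n - \<tau> v) < inverse (Suc n)" for n
    using map_dense[OF ymem, of "inverse (Suc n)"] by (metis inverse_positive_iff_positive of_nat_0_less_iff zero_less_Suc)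
  then obtain v where v [simp]: "\<And>n. v n \<in> hcarrier V"
    and vy: "\<And>n. hnorm completion (y n - \<tau> (v n)) < inverse (Suc n)" by metis
  have "(\<lambda>n. hnorm completion (y n - \<tau> (v n) - 0)) \<longlonglongrightarrow> 0"
    by (rule tendsto_zero_le[OF LIMSEQ_inverse_real_of_nat])
      (use vy less_imp_le in \<open>auto simp: completion.hnorm_nonneg\<close>)
  then have lim0: "hlim completion (\<lambda>n. y n - \<tau> (v n)) 0" by (simp add: hlim_def)
  then have c: "hcauchy completion (\<lambda>n. \<tau> (v n))"
    using completion.hcauchy_diff[OF y completion.hlim_imp_hcauchy[OF lim0]] by simp
  have "hnorm completion (\<tau> (v m) - \<tau> (v n)) = hnorm V (v m - v n)" for m n
  proof -
    have "\<tau> (v m - v n) = \<tau> (v m) - \<tau> (v n)"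
      using map_add[of "v m - v n" "v n"] by simp
    then show ?thesis using completion_ip_map[of "v m - v n" "v m - v n"] by (simp add: hnorm_def)
  qed
  then have cV: "hcauchy V v" by (intro hcauchy_mono[OF c]) simp_all
  have "hcauchy X (\<lambda>n. \<tau> (v n))"
    by (rule hcauchy_mono[OF c]) (use hnorm_le_completion in simp_all)
  then obtain z where "hlim X (\<lambda>n. \<tau> (v n)) z" using X.hcauchy_convergent by blast
  then have "hlim completion (\<lambda>n. \<tau> (v n)) z" using cV by (intro approx_hlim) (simp add: approx_def)
  then have "hlim completion (\<lambda>n. y n - \<tau> (v n) + \<tau> (v n)) (0 + z)" by (rule completion.hlim_add[OF lim0])
  then show "\<exists>z. hlim completion y z" by auto
qed

end

subsection \<open>Selfadjoint relations\<close>

context hilbert_space begin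

lemma monotone_symmetric_range_imp:
  assumes mono: "monotone_rel X h"
    and sym: "\<And>b v b' v'. (b, v) \<in> h \<Longrightarrow> (b', v') \<in> h \<Longrightarrow> hinner X v b' = hinner X b v'"
    and range: "\<And>f. f \<in> hcarrier X \<Longrightarrow> \<exists>b. (b, f - b) \<in> h"
  shows "maximal_monotone_rel X h" "selfadjoint_rel X h"
proof -
  have sub: "h \<subseteq> hcarrier X \<times> hcarrier X" using mono by (simp add: monotone_rel_def)
  have mem: "x \<in> hcarrier X" "y \<in> hcarrier X" if "(x, y) \<in> h" for x y using that sub by auto
  show "maximal_monotone_rel X h"
    unfolding maximal_monotone_rel_def
  proof (intro conjI mono notI)
    assume "\<exists>h'. monotone_rel X h' \<and> h \<subset> h'"
    then obtain h' x y where h': "monotone_rel X h'" "h \<subseteq> h'" and xy: "(x, y) \<in> h'" "(x, y) \<notin> h"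
      by auto
    have [simp]: "x \<in> hcarrier X" "y \<in> hcarrier X" using h'(1) xy by (auto simp: monotone_rel_def)
    obtain b where b: "(b, x + y - b) \<in> h" using range[of "x + y"] by auto
    have [simp]: "b \<in> hcarrier X" using mem[OF b] by simp
    have "0 \<le> Re (hinner X (x - b) (y - (x + y - b)))"
      using h' xy b unfolding monotone_rel_def by fast
    also have "y - (x + y - b) = - (x - b)" by simp
    also have "hinner X (x - b) (- (x - b)) = - hinner X (x - b) (x - b)"
      by (rule ip_neg_right) simp_all
    finally have "x - b = 0" using ip_pos[of "x - b"] by fastforce
    then show False using b xy(2) by simp
  qed
  have "(x, y) \<in> h" if adj: "(x, y) \<in> adjoint_rel X X h" for x y
  proof -
    have [simp]: "x \<in> hcarrier X" "y \<in> hcarrier X" using adj by (auto simp: mem_adjoint_rel)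
    obtain b where b: "(b, x + y - b) \<in> h" using range[of "x + y"] by auto
    have [simp]: "b \<in> hcarrier X" using mem[OF b] by simp
    obtain c where c: "(c, x - b - c) \<in> h" using range[of "x - b"] by auto
    have [simp]: "c \<in> hcarrier X" using mem[OF c] by simp
    have "hinner X (x - b - c) x = hinner X c y" using adj c by (auto simp: mem_adjoint_rel)
    moreover have "hinner X (x - b - c) b = hinner X c (x + y - b)" using sym[OF c b] .
    ultimately have "hinner X (x - b - c) (x - b) = hinner X c (b - x)"
      by (simp only: ip_simps diff_mem add_mem mem[OF b] mem[OF c]
          \<open>x \<in> hcarrier X\<close> \<open>y \<in> hcarrier X\<close>) simp
    then have "hinner X (x - b) (x - b) = 0"
      using ip_diff_left[of "x - b" c "x - b"] ip_neg_right[of c "x - b"] by simp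
    then have "x = b" using ip_self_eq_zero[of "x - b"] by simp
    then show ?thesis using b by simp
  qed
  moreover have "(x, y) \<in> adjoint_rel X X h" if "(x, y) \<in> h" for x y
    using that mem sym unfolding mem_adjoint_rel by blast
  ultimately show "selfadjoint_rel X h" using sub by (auto simp: selfadjoint_rel_def)
qed

end

locale positive_selfadjoint = hilbert_space X for X :: "'a::complex_vector hspace" +
  fixes h :: "('a \<times> 'a) set"
  assumes monotone: "monotone_rel X h" and selfadjoint: "selfadjoint_rel X h"
begin

lemma adjoint_h: "adjoint_rel X X h = h"
  using selfadjoint by (simp add: selfadjoint_rel_def)

lemma h_subset: "h \<subseteq> hcarrier X \<times> hcarrier X"
  using monotone by (simp add: monotone_rel_def)

lemma h_mem: "(x, y) \<in> h \<Longrightarrow> x \<in> hcarrier X" "(x, y) \<in> h \<Longrightarrow> y \<in> hcarrier X"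
  using h_subset by auto

lemma subspace_h: "complex_vector.subspace h"
  using subspace_adjoint_rel[OF semi_inner_axioms semi_inner_axioms h_subset] by (simp add: adjoint_h)

lemma h_zero: "(0, 0) \<in> h"
  using complex_vector.subspace_0[OF subspace_h] by (simp add: zero_prod_def)

lemma h_add: "(x, y) \<in> h \<Longrightarrow> (u, v) \<in> h \<Longrightarrow> (x + u, y + v) \<in> h"
  using complex_vector.subspace_add[OF subspace_h, of "(x, y)" "(u, v)"] by simp

lemma h_diff: "(x, y) \<in> h \<Longrightarrow> (u, v) \<in> h \<Longrightarrow> (x - u, y - v) \<in> h"
  using complex_vector.subspace_diff[OF subspace_h, of "(x, y)" "(u, v)"] by simp

lemma h_scale: "(x, y) \<in> h \<Longrightarrow> (c *\<^sub>C x, c *\<^sub>C y) \<in> h"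
  using complex_vector.subspace_scale[OF subspace_h, of "(x, y)" c] by simp

lemma h_nonneg: "(x, y) \<in> h \<Longrightarrow> 0 \<le> Re (hinner X x y)"
  using monotone h_zero unfolding monotone_rel_def by (metis (no_types, lifting) case_prodD diff_zero)

lemma h_symmetric:
  assumes "(x, y) \<in> h" "(u, v) \<in> h"
  shows "hinner X y u = hinner X x v"
proof -
  have "(u, v) \<in> adjoint_rel X X h" using assms(2) by (simp only: adjoint_h)
  then show ?thesis using assms(1) by (simp add: mem_adjoint_rel)
qed

lemma h_norm_sum:
  assumes "(x, y) \<in> h"
  shows "hnorm X x \<le> hnorm X (x + y)" "hnorm X y \<le> hnorm X (x + y)"
proof -
  have [simp]: "x \<in> hcarrier X" "y \<in> hcarrier X" using h_mem assms by auto
  have "(hnorm X x)\<^sup>2 \<le> (hnorm X (x + y))\<^sup>2" "(hnorm X y)\<^sup>2 \<le> (hnorm X (x + y))\<^sup>2"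
    using hnorm_add_power2[of x y] h_nonneg[OF assms] by simp_all
  then show "hnorm X x \<le> hnorm X (x + y)" "hnorm X y \<le> hnorm X (x + y)"
    by (auto intro: power2_le_imp_le simp: hnorm_nonneg)
qed

lemma closedin_range: "closedin (htopology X) {x + y | x y. (x, y) \<in> h}"
  unfolding closedin_iff_hlim
proof (intro conjI allI impI)
  show "{x + y | x y. (x, y) \<in> h} \<subseteq> hcarrier X" using h_mem by auto
  fix s f assume *: "(\<forall>n. s n \<in> {x + y | x y. (x, y) \<in> h}) \<and> hlim X s f"
  then have "\<forall>n. \<exists>x y. s n = x + y \<and> (x, y) \<in> h" by auto
  then obtain x y where s: "\<And>n. s n = x n + y n" and xy: "\<And>n. (x n, y n) \<in> h" by metis
  have cs: "hcauchy X s" using * hlim_imp_hcauchy by blast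
  have "s m - s n = (x m - x n) + (y m - y n)" for m n by (simp add: s)
  then have le: "hnorm X (x m - x n) \<le> hnorm X (s m - s n)" "hnorm X (y m - y n) \<le> hnorm X (s m - s n)" for m n
    using h_norm_sum[OF h_diff[OF xy[of m] xy[of n]]] by simp_all
  have "hcauchy X x" "hcauchy X y"
    by (rule hcauchy_mono[OF cs h_mem(1)[OF xy] le(1)], rule hcauchy_mono[OF cs h_mem(2)[OF xy] le(2)])
  then obtain a b where ab: "hlim X x a" "hlim X y b" using hcauchy_convergent by blast
  interpret XX: hilbert_space "X \<oplus>\<^sub>H X" by (intro hilbert_space_hsum hilbert_space_axioms)
  have cl: "closedin (htopology (X \<oplus>\<^sub>H X)) h"
    using closedin_adjoint_rel[OF hilbert_space_axioms hilbert_space_axioms h_subset]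
    by (simp add: adjoint_h)
  have lim: "hlim (X \<oplus>\<^sub>H X) (\<lambda>n. (x n, y n)) (a, b)"
    using ab by (simp add: hlim_hsum_iff semi_inner_axioms)
  have "(a, b) \<in> h" by (rule XX.closedin_hlim[OF cl xy lim])
  moreover have "f = a + b"
  proof (rule hlim_unique)
    show "hlim X s f" using * by simp
    show "hlim X s (a + b)" using hlim_add[OF ab] by (simp flip: s)
  qed
  ultimately show "f \<in> {x + y | x y. (x, y) \<in> h}" by blast
qed

lemma range_one_plus:
  assumes f: "f \<in> hcarrier X"
  shows "\<exists>b. (b, f - b) \<in> h"
proof -
  let ?S = "{x + y | x y. (x, y) \<in> h}"
  have sub: "complex_vector.subspace ?S"
  proof (rule complex_vector.subspaceI)
    show "0 \<in> ?S" using h_zero by force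
    show "p + q \<in> ?S" if pq: "p \<in> ?S" "q \<in> ?S" for p q
    proof -
      obtain x y u v where "p = x + y" "q = u + v" "(x, y) \<in> h" "(u, v) \<in> h" using pq by blast
      then have "p + q = (x + u) + (y + v)" "(x + u, y + v) \<in> h" using h_add by simp_all
      then show ?thesis by blast
    qed
    show "c *\<^sub>C p \<in> ?S" if "p \<in> ?S" for c p
      using that h_scale scaleC_add_right by blast
  qed
  obtain p where p: "p \<in> ?S" and orth: "\<And>q. q \<in> ?S \<Longrightarrow> hinner X q (f - p) = 0"
    using projection_exists[OF sub closedin_range f] by blast
  define d where "d = f - p"
  have [simp]: "d \<in> hcarrier X" using f p h_mem by (auto simp: d_def)
  have "(d, - d) \<in> adjoint_rel X X h"
    unfolding mem_adjoint_rel
  proof (intro conjI allI impI)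
    fix u v assume uv: "(u, v) \<in> h"
    then have "hinner X (u + v) d = 0" using orth d_def by blast
    then show "hinner X v d = hinner X u (- d)"
      using h_mem[OF uv] by (simp add: ip_simps eq_neg_iff_add_eq_0 add.commute)
  qed simp_all
  then have "0 \<le> Re (hinner X d (- d))" using adjoint_h h_nonneg by simp
  then have "d = 0" using ip_pos[of d] by (fastforce simp: ip_simps)
  then obtain x y where "f = x + y" "(x, y) \<in> h" using p by (auto simp: d_def)
  then show ?thesis by (auto intro!: exI[of _ x])
qed

definition resolvent :: "'a \<Rightarrow> 'a" where
  "resolvent f = (SOME b. (b, f - b) \<in> h)"

lemma resolvent_in: "f \<in> hcarrier X \<Longrightarrow> (resolvent f, f - resolvent f) \<in> h"
  unfolding resolvent_def by (rule someI_ex) (rule range_one_plus)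

lemma resolvent_unique:
  assumes "(b, v) \<in> h"
  shows "resolvent (b + v) = b"
proof -
  have [simp]: "b \<in> hcarrier X" "v \<in> hcarrier X" using h_mem assms by auto
  have "(resolvent (b + v), b + v - resolvent (b + v)) \<in> h" by (rule resolvent_in) simp
  note h_norm_sum(1)[OF h_diff[OF this assms]]
  then have "hnorm X (resolvent (b + v) - b) \<le> 0" by (simp add: hnorm_zero)
  moreover have "resolvent (b + v) \<in> hcarrier X" using resolvent_in[of "b + v"] h_mem by simp
  ultimately show ?thesis
    using hnorm_eq_zero[of "resolvent (b + v) - b"] hnorm_nonneg[of "resolvent (b + v) - b"] by simp
qed

lemma resolvent_mem [simp]: "f \<in> hcarrier X \<Longrightarrow> resolvent f \<in> hcarrier X"
  using resolvent_in h_mem by blast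

lemma resolvent_add:
  assumes "f \<in> hcarrier X" "g \<in> hcarrier X"
  shows "resolvent (f + g) = resolvent f + resolvent g"
  using resolvent_unique[OF h_add[OF resolvent_in resolvent_in, OF assms]] by (simp add: algebra_simps)

lemma resolvent_scale:
  assumes "f \<in> hcarrier X"
  shows "resolvent (c *\<^sub>C f) = c *\<^sub>C resolvent f"
  using resolvent_unique[OF h_scale[OF resolvent_in, OF assms, of c]]
  by (simp flip: scaleC_add_right)

lemma resolvent_symmetric:
  assumes "f \<in> hcarrier X" "g \<in> hcarrier X"
  shows "hinner X f (resolvent g) = hinner X (resolvent f) g"
  using h_symmetric[OF resolvent_in resolvent_in, OF assms] assms by (simp add: ip_simps)

lemma resolvent_ge:
  assumes "f \<in> hcarrier X"
  shows "(hnorm X (resolvent f))\<^sup>2 \<le> Re (hinner X f (resolvent f))"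
  using h_nonneg[OF resolvent_in, OF assms] assms
  by (simp add: hnorm_power2 resolvent_symmetric ip_simps)

text \<open>The form domain of \<open>1 + h\<close>, as the completion of the range of the resolvent
  \<open>R = (1 + h)\<inverse>\<close> with respect to \<open>\<langle>R f | R g\<rangle> = \<langle>f | R g\<rangle>\<^sub>X\<close>.\<close>

lemma form_space:
  obtains B where "hilbert_space B" "hcarrier B \<subseteq> hcarrier X"
    "\<And>x. x \<in> hcarrier B \<Longrightarrow> hnorm X x \<le> hnorm B x"
    "\<And>f. f \<in> hcarrier X \<Longrightarrow> resolvent f \<in> hcarrier B"
    "\<And>f x. f \<in> hcarrier X \<Longrightarrow> x \<in> hcarrier B \<Longrightarrow> hinner B (resolvent f) x = hinner X f x"
proof -
  define V where "V = \<lparr>hcarrier = hcarrier X, hinner = (\<lambda>f g. hinner X f (resolvent g))\<rparr>"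
  have V [simp]: "hcarrier V = hcarrier X" "hinner V f g = hinner X f (resolvent g)" for f g
    by (simp_all add: V_def)
  interpret closable_map V X resolvent
  proof
    show "complex_vector.subspace (hcarrier V)" using subspace_hcarrier by simp
    fix f assume f: "f \<in> hcarrier V"
    show "0 \<le> Re (hinner V f f)"
      using resolvent_ge[of f] f order_trans[OF zero_le_power2] by auto
    show "resolvent f \<in> hcarrier X" "resolvent (c *\<^sub>C f) = c *\<^sub>C resolvent f" for c
      using f by (simp_all add: resolvent_scale)
    show "hnorm X (resolvent f) \<le> hnorm V f"
      using resolvent_ge[of f] f by (simp add: hnorm_def[of V] real_le_rsqrt)
    show "\<exists>C. \<forall>w\<in>hcarrier V. cmod (hinner V f w) \<le> C * hnorm X (resolvent w)"
      using f cauchy_schwarz by (intro exI[of _ "hnorm X f"]) simp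
    fix g assume g: "g \<in> hcarrier V"
    show "hinner V f g = cnj (hinner V g f)"
      using f g resolvent_symmetric[of f g] ip_commute[of "resolvent f" g] by simp
    show "hinner V f (c *\<^sub>C g) = c * hinner V f g" for c
      using f g by (simp add: resolvent_scale ip_simps)
    show "resolvent (f + g) = resolvent f + resolvent g" using f g by (simp add: resolvent_add)
    fix k assume "k \<in> hcarrier V"
    then show "hinner V f (g + k) = hinner V f g + hinner V f k"
      using f g by (simp add: resolvent_add ip_simps)
  qed
  show thesis
  proof (rule that[OF hilbert_space_completion])
    show "hcarrier completion \<subseteq> hcarrier X" using completion_subset by blast
    show "resolvent f \<in> hcarrier completion" if "f \<in> hcarrier X" for f using that by simp
    fix f x assume f: "f \<in> hcarrier X" and x: "x \<in> hcarrier completion"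
    obtain s where s: "approx s x" using x mem_completion by blast
    show "hinner completion (resolvent f) x = hinner X f x"
    proof (rule LIMSEQ_unique)
      show "(\<lambda>n. hinner V f (s n)) \<longlonglongrightarrow> hinner completion (resolvent f) x"
        using f by (intro approx_ip approx_const s) simp
      show "(\<lambda>n. hinner V f (s n)) \<longlonglongrightarrow> hinner X f x"
        using f s unfolding V by (intro hlim_ip hlim_const) (auto simp: approx_def)
    qed
  qed (rule hnorm_le_completion)
qed

end

text \<open>For a contractive embedding \<open>J : B \<rightarrow> X\<close> with adjoint \<open>R\<close>, the map \<open>k = 1 - R J\<close> into the
  completion of its range serves as a defect operator, \<open>k\<^sup>* k = 1 - J\<^sup>* J\<close>; this
  replaces a square root of \<open>1 - J\<^sup>* J\<close>.\<close>

lemma defect_operator: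
  fixes X B :: "'a::complex_vector hspace"
  assumes X: "hilbert_space X" and B: "hilbert_space B" and sub: "hcarrier B \<subseteq> hcarrier X"
    and contr: "\<And>x. x \<in> hcarrier B \<Longrightarrow> hnorm X x \<le> hnorm B x"
    and R_mem: "\<And>x. x \<in> hcarrier B \<Longrightarrow> R x \<in> hcarrier B"
    and R_add: "\<And>x y. x \<in> hcarrier B \<Longrightarrow> y \<in> hcarrier B \<Longrightarrow> R (x + y) = R x + R y"
    and R_scale: "\<And>c x. x \<in> hcarrier B \<Longrightarrow> R (c *\<^sub>C x) = c *\<^sub>C R x"
    and R_adj: "\<And>x y. x \<in> hcarrier B \<Longrightarrow> y \<in> hcarrier B \<Longrightarrow> hinner B (R x) y = hinner X x y"
  obtains U :: "'a hspace" and k where "hilbert_space U"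
    "\<And>x. x \<in> hcarrier B \<Longrightarrow> k x \<in> hcarrier U"
    "\<And>x y. x \<in> hcarrier B \<Longrightarrow> y \<in> hcarrier B \<Longrightarrow> k (x + y) = k x + k y"
    "\<And>c x. x \<in> hcarrier B \<Longrightarrow> k (c *\<^sub>C x) = c *\<^sub>C k x"
    "\<And>x y. x \<in> hcarrier B \<Longrightarrow> y \<in> hcarrier B \<Longrightarrow> hinner U (k x) (k y) = hinner B x y - hinner X x y"
proof -
  interpret X: hilbert_space X by fact
  interpret B: hilbert_space B by fact
  have [simp]: "x \<in> hcarrier X" if "x \<in> hcarrier B" for x using sub that by blast
  define V where "V = \<lparr>hcarrier = hcarrier B, hinner = (\<lambda>x y. hinner B x y - hinner X x y)\<rparr>"
  have V [simp]: "hcarrier V = hcarrier B" "hinner V x y = hinner B x y - hinner X x y" for x y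
    by (simp_all add: V_def)
  define k where "k = (\<lambda>x. x - R x)"
  note [simp] = R_mem
  interpret V: semi_inner V
  proof
    show "complex_vector.subspace (hcarrier V)" using B.subspace_hcarrier by simp
    fix x assume x: "x \<in> hcarrier V"
    show "0 \<le> Re (hinner V x x)"
      using contr[of x] x power_mono[of "hnorm X x" "hnorm B x" 2]
      by (simp add: X.hnorm_nonneg B.hnorm_power2 X.hnorm_power2)
    fix y assume y: "y \<in> hcarrier V"
    show "hinner V x y = cnj (hinner V y x)"
      using x y B.ip_commute[of x y] X.ip_commute[of x y] by simp
  qed (simp_all add: X.ip_simps B.ip_simps algebra_simps)
  have V_le_B: "hnorm V x \<le> hnorm B x" if "x \<in> hcarrier B" for x
    unfolding hnorm_def using that X.ip_nonneg[of x] by simp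
  have k_ip: "hinner B x (k y) = hinner V x y" if "x \<in> hcarrier B" "y \<in> hcarrier B" for x y
    using that R_adj[of y x] B.ip_commute[of x "R y"] X.ip_commute[of x y] by (simp add: k_def B.ip_simps)
  have k_mem: "k x \<in> hcarrier B" if "x \<in> hcarrier B" for x using that by (simp add: k_def)
  interpret closable_map V B k
  proof
    fix x assume x: "x \<in> hcarrier V"
    show "k x \<in> hcarrier B" using x k_mem by simp
    show "k (c *\<^sub>C x) = c *\<^sub>C k x" for c
      using x by (simp add: k_def R_scale complex_vector.scale_right_diff_distrib)
    show "k (x + y) = k x + k y" if "y \<in> hcarrier V" for y
      using x that by (simp add: k_def R_add)
    have "cmod (hinner V x w) \<le> hnorm B x * hnorm B (k w)" if "w \<in> hcarrier B" for w
      using x that k_mem[of w] k_ip[of x w] B.cauchy_schwarz[of x "k w"] by simp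
    then show "\<exists>C. \<forall>w\<in>hcarrier V. cmod (hinner V x w) \<le> C * hnorm B (k w)" by auto
    have kx: "k x \<in> hcarrier B" using x k_mem by simp
    have "hnorm B (k x) * hnorm B (k x) = cmod (hinner V (k x) x)"
    proof -
      have "hinner V (k x) x = of_real ((hnorm B (k x))\<^sup>2)"
        using k_ip[OF kx, of x] x B.ip_self[OF kx] by simp
      then show ?thesis
        by (simp only: norm_of_real) (simp add: power2_eq_square B.hnorm_nonneg[OF kx])
    qed
    also have "\<dots> \<le> hnorm V (k x) * hnorm V x" using x kx by (intro V.cauchy_schwarz) simp_all
    also have "\<dots> \<le> hnorm B (k x) * hnorm V x"
      using V_le_B[OF kx] V.hnorm_nonneg[OF x] by (rule mult_right_mono)
    finally show "hnorm B (k x) \<le> hnorm V x"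
      using B.hnorm_nonneg[OF kx] V.hnorm_nonneg[OF x]
      by (cases "hnorm B (k x) = 0") auto
  qed
  show thesis
    by (rule that[OF hilbert_space_completion, of k])
      (use map_add map_scale in \<open>simp_all add: completion_ip_map\<close>)
qed

lemma op_app_graph_on [simp]: "x \<in> S \<Longrightarrow> op_app (graph_on S f) x = f x"
  unfolding op_app_def graph_on_def by (rule the_equality) auto

lemma Domain_graph_on [simp]: "Domain (graph_on S f) = S"
  unfolding graph_on_def by force

lemma closed_operator_graph_onI:
  fixes X :: "'a::complex_vector hspace" and Y :: "'b::complex_vector hspace"
  assumes X: "hilbert_space X" and Y: "hilbert_space Y"
    and S: "complex_vector.subspace S" "S \<subseteq> hcarrier X"
    and f: "\<And>x. x \<in> S \<Longrightarrow> f x \<in> hcarrier Y"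
      "\<And>x y. x \<in> S \<Longrightarrow> y \<in> S \<Longrightarrow> f (x + y) = f x + f y"
      "\<And>c x. x \<in> S \<Longrightarrow> f (c *\<^sub>C x) = c *\<^sub>C f x"
    and closed: "\<And>s x y. (\<And>n. s n \<in> S) \<Longrightarrow> hlim X s x \<Longrightarrow> hlim Y (\<lambda>n. f (s n)) y \<Longrightarrow> x \<in> S \<and> f x = y"
  shows "closed_operator X Y (graph_on S f)"
proof -
  interpret X: hilbert_space X by fact
  interpret Y: hilbert_space Y by fact
  interpret XY: hilbert_space "X \<oplus>\<^sub>H Y" by (rule hilbert_space_hsum) fact+
  have sub: "graph_on S f \<subseteq> hcarrier X \<times> hcarrier Y" using S(2) f(1) by (auto simp: graph_on_def)
  have mem: "p \<in> graph_on S f \<longleftrightarrow> fst p \<in> S \<and> snd p = f (fst p)" for p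
    by (cases p) (auto simp: graph_on_def)
  have f0: "f 0 = 0" using f(3)[OF complex_vector.subspace_0[OF S(1)], of 0] by simp
  have "complex_vector.subspace (graph_on S f)"
    by (rule complex_vector.subspaceI)
      (simp_all add: mem f f0 complex_vector.subspace_0[OF S(1)] complex_vector.subspace_add[OF S(1)]
        complex_vector.subspace_scale[OF S(1)])
  moreover have "single_valued (graph_on S f)" by (rule single_valuedI) (simp add: mem)
  moreover have "closedin (htopology (X \<oplus>\<^sub>H Y)) (graph_on S f)"
    unfolding XY.closedin_iff_hlim
  proof (intro conjI allI impI)
    show "graph_on S f \<subseteq> hcarrier (X \<oplus>\<^sub>H Y)" using sub by simp
    fix s p assume *: "(\<forall>n. s n \<in> graph_on S f) \<and> hlim (X \<oplus>\<^sub>H Y) s p"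
    then have lim: "hlim X (\<lambda>n. fst (s n)) (fst p)" "hlim Y (\<lambda>n. snd (s n)) (snd p)"
      by (simp_all add: hlim_hsum_iff X.semi_inner_axioms Y.semi_inner_axioms)
    have s: "fst (s n) \<in> S" "snd (s n) = f (fst (s n))" for n using * by (simp_all add: mem)
    show "p \<in> graph_on S f" using closed[OF s(1) lim(1)] lim(2) by (simp add: mem s(2))
  qed
  ultimately show ?thesis using sub by (simp add: closed_operator_def linear_operator_def)
qed

text \<open>Every relation \<open>k\<^sup>* k\<close> is symmetric, so it equals a selfadjoint relation
  as soon as it contains it.\<close>

lemma (in positive_selfadjoint) factorization:
  obtains B and U :: "'a hspace" and k where
    "hilbert_space U" "closed_operator X U (graph_on B k)"
    "h = {(b, v) \<in> B \<times> hcarrier X. \<forall>x\<in>B. hinner U (k b) (k x) = hinner X v x}"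
proof -
  obtain Bs where Bs: "hilbert_space Bs" "hcarrier Bs \<subseteq> hcarrier X"
    "\<And>x. x \<in> hcarrier Bs \<Longrightarrow> hnorm X x \<le> hnorm Bs x"
    "\<And>f. f \<in> hcarrier X \<Longrightarrow> resolvent f \<in> hcarrier Bs"
    "\<And>f x. f \<in> hcarrier X \<Longrightarrow> x \<in> hcarrier Bs \<Longrightarrow> hinner Bs (resolvent f) x = hinner X f x"
    using form_space by blast
  interpret Bs: hilbert_space Bs by fact
  have [simp]: "x \<in> hcarrier X" if "x \<in> hcarrier Bs" for x using Bs(2) that by blast
  obtain U :: "'a hspace" and k where U: "hilbert_space U" and k:
    "\<And>x. x \<in> hcarrier Bs \<Longrightarrow> k x \<in> hcarrier U"
    "\<And>x y. x \<in> hcarrier Bs \<Longrightarrow> y \<in> hcarrier Bs \<Longrightarrow> k (x + y) = k x + k y"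
    "\<And>c x. x \<in> hcarrier Bs \<Longrightarrow> k (c *\<^sub>C x) = c *\<^sub>C k x"
    "\<And>x y. x \<in> hcarrier Bs \<Longrightarrow> y \<in> hcarrier Bs \<Longrightarrow> hinner U (k x) (k y) = hinner Bs x y - hinner X x y"
    by (rule defect_operator[OF hilbert_space_axioms Bs(1-3), of resolvent])
      (simp_all add: Bs(4,5) resolvent_add resolvent_scale, blast)
  interpret U: hilbert_space U by fact
  note [simp] = k(1)
  let ?S = "{(b, v) \<in> hcarrier Bs \<times> hcarrier X. \<forall>x\<in>hcarrier Bs. hinner U (k b) (k x) = hinner X v x}"
  have k_diff: "k (x - y) = k x - k y" if "x \<in> hcarrier Bs" "y \<in> hcarrier Bs" for x y
    using k(2)[of "x - y" y] that by simp
  have norm: "(hnorm Bs x)\<^sup>2 = (hnorm X x)\<^sup>2 + (hnorm U (k x))\<^sup>2" if "x \<in> hcarrier Bs" for x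
    using that k(4)[of x x] by (simp add: hnorm_power2 Bs.hnorm_power2 U.hnorm_power2)
  have "closed_operator X U (graph_on (hcarrier Bs) k)"
  proof (rule closed_operator_graph_onI[OF hilbert_space_axioms U Bs.subspace_hcarrier Bs(2) k(1-3)])
    fix s x y
    assume s [simp]: "\<And>n. s n \<in> hcarrier Bs" and x: "hlim X s x" and y: "hlim U (\<lambda>n. k (s n)) y"
    have XU: "semi_inner X" "semi_inner U" by unfold_locales
    interpret XU: hilbert_space "X \<oplus>\<^sub>H U" by (intro hilbert_space_hsum hilbert_space_axioms U)
    have "hcauchy (X \<oplus>\<^sub>H U) (\<lambda>n. (s n, k (s n)))"
      by (rule XU.hlim_imp_hcauchy[of _ "(x, y)"]) (simp add: hlim_hsum_iff[OF XU] x y)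
    then have "hcauchy Bs s"
    proof (rule hcauchy_mono)
      fix m n
      have "(hnorm Bs (s m - s n))\<^sup>2 = (hnorm (X \<oplus>\<^sub>H U) ((s m, k (s m)) - (s n, k (s n))))\<^sup>2"
        by (simp add: norm hnorm_hsum_power2[OF XU] k_diff)
      moreover have "0 \<le> hnorm (X \<oplus>\<^sub>H U) ((s m, k (s m)) - (s n, k (s n)))"
        by (rule XU.hnorm_nonneg) simp
      ultimately show "hnorm Bs (s m - s n) \<le> hnorm (X \<oplus>\<^sub>H U) ((s m, k (s m)) - (s n, k (s n)))"
        by (simp add: Bs.hnorm_nonneg)
    qed simp
    then obtain z where z: "hlim Bs s z" using Bs.hcauchy_convergent by blast
    then have zm [simp]: "z \<in> hcarrier Bs" and z0: "(\<lambda>n. hnorm Bs (s n - z)) \<longlonglongrightarrow> 0" by (auto simp: hlim_def)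
    have "(\<lambda>n. hnorm X (s n - z)) \<longlonglongrightarrow> 0"
      by (rule tendsto_zero_le[OF z0]) (simp_all add: hnorm_nonneg Bs(3))
    then have "hlim X s z" by (simp add: hlim_def)
    then have "x = z" using x hlim_unique by blast
    have "(\<lambda>n. hnorm U (k (s n) - k z)) \<longlonglongrightarrow> 0"
    proof (rule tendsto_zero_le[OF z0])
      fix n
      have "(hnorm U (k (s n - z)))\<^sup>2 \<le> (hnorm Bs (s n - z))\<^sup>2" by (simp add: norm)
      then show "hnorm U (k (s n) - k z) \<le> hnorm Bs (s n - z)"
        unfolding k_diff[OF s zm, symmetric] by (rule power2_le_imp_le) (simp add: Bs.hnorm_nonneg)
    qed (simp add: U.hnorm_nonneg)
    then have "hlim U (\<lambda>n. k (s n)) (k z)" by (simp add: hlim_def)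
    then show "x \<in> hcarrier Bs \<and> k x = y" using y U.hlim_unique \<open>x = z\<close> zm by blast
  qed
  moreover have "h = ?S"
  proof
    show "h \<subseteq> ?S"
    proof clarify
      fix b v assume bv: "(b, v) \<in> h"
      then have [simp]: "b \<in> hcarrier X" "v \<in> hcarrier X" using h_mem by auto
      have b: "b = resolvent (b + v)" using resolvent_unique[OF bv] by simp
      then have [simp]: "b \<in> hcarrier Bs" using Bs(4)[of "b + v"] by simp
      have "hinner U (k b) (k x) = hinner X v x" if x [simp]: "x \<in> hcarrier Bs" for x
      proof -
        have "hinner Bs b x = hinner X (b + v) x" using Bs(5)[of "b + v" x] b by simp
        then show ?thesis by (simp add: k(4) ip_simps)
      qed
      then show "(b, v) \<in> hcarrier Bs \<times> hcarrier X \<and> (\<forall>x\<in>hcarrier Bs. hinner U (k b) (k x) = hinner X v x)" by simp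
    qed
    then have hS: "(b, v) \<in> ?S" if "(b, v) \<in> h" for b v using that by blast
    show "?S \<subseteq> h"
    proof clarify
      fix b v assume b [simp]: "b \<in> hcarrier Bs" "v \<in> hcarrier X"
        and eq: "\<forall>x\<in>hcarrier Bs. hinner U (k b) (k x) = hinner X v x"
      have "(b, v) \<in> adjoint_rel X X h"
        unfolding mem_adjoint_rel
      proof (intro conjI allI impI)
        fix b' v' assume "(b', v') \<in> h"
        from hS[OF this] have [simp]: "b' \<in> hcarrier Bs" "v' \<in> hcarrier X"
          and eq': "\<forall>x\<in>hcarrier Bs. hinner U (k b') (k x) = hinner X v' x" by auto
        have "hinner X v' b = hinner U (k b') (k b)" using eq' by simp
        also have "\<dots> = cnj (hinner X v b')" using eq U.ip_commute[of "k b'" "k b"] by simp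
        finally show "hinner X v' b = hinner X b' v" using ip_commute[of b' v] by simp
      qed simp_all
      then show "(b, v) \<in> h" by (simp add: adjoint_h)
    qed
  qed
  ultimately show thesis using that[OF U] by blast
qed

subsection \<open>Boundary spaces\<close>

locale closed_extension = T0: closed_op X Y T0 + T: closed_op X Y T
  for X :: "'a::complex_vector hspace" and Y :: "'b::complex_vector hspace" and T0 T +
  assumes extends: "T0 \<subseteq> T"
begin

abbreviation "BD \<equiv> boundary_space X Y T0 T"
abbreviation "\<pi> \<equiv> boundary_proj X Y T0 T"

lemma ext_dom: "x \<in> Domain T0 \<Longrightarrow> x \<in> Domain T"
  using extends by blast

lemma ext_app: "x \<in> Domain T0 \<Longrightarrow> op_app T0 x = op_app T x"
  using extends T0.app_in T.app_eq by (metis subsetD)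

lemma hinner_BD: "hinner BD x y = hinner X x y + hinner Y (op_app T x) (op_app T y)"
  by (simp add: boundary_space_def hinner_graph_space)

lemma mem_BD:
  "x \<in> hcarrier BD \<longleftrightarrow> x \<in> Domain T \<and>
     (\<forall>s\<in>Domain T0. hinner X s x + hinner Y (op_app T s) (op_app T x) = 0)"
  by (simp add: boundary_space_def hcarrier_orth_compl hinner_graph_space)

lemma BD_dom: "x \<in> hcarrier BD \<Longrightarrow> x \<in> Domain T"
  by (simp add: mem_BD)

sublocale BD: hilbert_space BD
  unfolding boundary_space_def by (rule T.graph.hilbert_space_orth_compl) (use ext_dom in auto)

lemma BD_orthogonal_right:
  assumes "x \<in> Domain T0" "b \<in> hcarrier BD"
  shows "hinner X b x + hinner Y (op_app T b) (op_app T x) = 0"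
proof -
  have "hinner X x b + hinner Y (op_app T x) (op_app T b) = 0" using assms by (simp add: mem_BD)
  then have "cnj (hinner X x b + hinner Y (op_app T x) (op_app T b)) = 0" by simp
  then show ?thesis
    using assms ext_dom[OF assms(1)] BD_dom[OF assms(2)]
      T0.X.ip_commute[of b x] T0.Y.ip_commute[of "op_app T b" "op_app T x"] by simp
qed

lemma boundary_proj_eqI:
  assumes x: "x \<in> Domain T" and b: "b \<in> hcarrier BD" and xb: "x - b \<in> Domain T0"
  shows "\<pi> x = b"
  unfolding boundary_proj_def orth_proj_def
proof (rule the_equality)
  have orth: "hinner (graph_space X Y T) s (x - b) = 0" if "s \<in> hcarrier BD" for s
    using BD_orthogonal_right[OF xb that] by (simp add: hinner_graph_space)
  then show "b \<in> hcarrier BD \<and> (\<forall>s\<in>hcarrier BD. hinner (graph_space X Y T) s (x - b) = 0)"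
    using b by blast
  fix p assume p: "p \<in> hcarrier BD \<and> (\<forall>s\<in>hcarrier BD. hinner (graph_space X Y T) s (x - p) = 0)"
  have d: "p - b \<in> hcarrier BD" using p b by blast
  have dom: "p \<in> Domain T" "b \<in> Domain T" using p b BD_dom by blast+
  have "hinner (graph_space X Y T) (p - b) ((x - b) - (x - p)) =
    hinner (graph_space X Y T) (p - b) (x - b) - hinner (graph_space X Y T) (p - b) (x - p)"
    by (rule T.graph.ip_diff_right) (use dom x in \<open>auto intro: T.app_diff\<close>)
  also have "\<dots> = 0" using orth[OF d] p d by simp
  finally have "hinner (graph_space X Y T) (p - b) (p - b) = 0" by simp
  then have "p - b = 0" using T.graph.ip_self_eq_zero[of "p - b"] dom T.app_diff(1) by simp
  then show "p = b" by simp
qed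

lemma decomposition:
  assumes x: "x \<in> Domain T"
  shows "\<pi> x \<in> hcarrier BD" "x - \<pi> x \<in> Domain T0"
proof -
  obtain p where p: "p \<in> T0" and
    orth: "\<And>s. s \<in> T0 \<Longrightarrow> hinner (X \<oplus>\<^sub>H Y) s ((x, op_app T x) - p) = 0"
    using T0.XY.projection_exists[OF T0.subspace_T T0.closedin_T, of "(x, op_app T x)"] x by auto
  obtain q where q: "q \<in> Domain T0" "p = (q, op_app T q)"
    using p ext_app by (cases p) (auto simp: T0.mem_iff)
  have "x - q \<in> hcarrier BD"
    unfolding mem_BD
  proof (intro conjI ballI)
    show "x - q \<in> Domain T" using x q ext_dom T.app_diff by blast
    fix s assume s: "s \<in> Domain T0"
    then have "(s, op_app T s) \<in> T0" using T0.app_in ext_app by metis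
    from orth[OF this] show "hinner X s (x - q) + hinner Y (op_app T s) (op_app T (x - q)) = 0"
      using x q ext_dom by (simp add: hinner_hsum T.app_diff)
  qed
  moreover have "x - (x - q) \<in> Domain T0" using q by simp
  ultimately have "\<pi> x = x - q" using x by (rule boundary_proj_eqI[rotated])
  with \<open>x - q \<in> hcarrier BD\<close> q show "\<pi> x \<in> hcarrier BD" "x - \<pi> x \<in> Domain T0" by simp_all
qed

lemma proj_dom: "x \<in> Domain T \<Longrightarrow> \<pi> x \<in> Domain T"
  using decomposition BD_dom by blast

lemma proj_BD: "b \<in> hcarrier BD \<Longrightarrow> \<pi> b = b"
  by (rule boundary_proj_eqI) (use BD_dom T0.app_zero in auto)

lemma proj_core: "x \<in> Domain T0 \<Longrightarrow> \<pi> x = 0"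
  by (rule boundary_proj_eqI) (use ext_dom in auto)

lemma proj_add: "x \<in> Domain T \<Longrightarrow> y \<in> Domain T \<Longrightarrow> \<pi> (x + y) = \<pi> x + \<pi> y"
  using T0.app_add(1)[of "x - \<pi> x" "y - \<pi> y"]
  by (intro boundary_proj_eqI) (auto simp: decomposition T.app_add algebra_simps)

lemma proj_scale: "x \<in> Domain T \<Longrightarrow> \<pi> (c *\<^sub>C x) = c *\<^sub>C \<pi> x"
  using T0.app_scale(1)[of "x - \<pi> x" c]
  by (intro boundary_proj_eqI) (auto simp: decomposition T.app_scale complex_vector.scale_right_diff_distrib)

lemma proj_diff: "x \<in> Domain T \<Longrightarrow> y \<in> Domain T \<Longrightarrow> \<pi> (x - y) = \<pi> x - \<pi> y"
  using proj_add[of "x - y" y] T.app_diff(1) by simp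

lemma hnorm_proj_le:
  assumes x: "x \<in> Domain T"
  shows "hnorm BD (\<pi> x) \<le> hnorm (graph_space X Y T) x"
proof (rule power2_le_imp_le)
  have dom: "\<pi> x \<in> Domain T" "x - \<pi> x \<in> Domain T"
    using x decomposition ext_dom proj_dom by blast+
  have "(hnorm (graph_space X Y T) (\<pi> x + (x - \<pi> x)))\<^sup>2 = (hnorm (graph_space X Y T) (\<pi> x))\<^sup>2
      + 2 * Re (hinner (graph_space X Y T) (\<pi> x) (x - \<pi> x)) + (hnorm (graph_space X Y T) (x - \<pi> x))\<^sup>2"
    by (rule T.graph.hnorm_add_power2) (use dom in simp_all)
  moreover have "hinner (graph_space X Y T) (\<pi> x) (x - \<pi> x) = 0"
    using BD_orthogonal_right[OF decomposition(2,1), OF x x] by (simp add: hinner_graph_space)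
  ultimately show "(hnorm BD (\<pi> x))\<^sup>2 \<le> (hnorm (graph_space X Y T) x)\<^sup>2"
    by (simp add: boundary_space_def)
  show "0 \<le> hnorm (graph_space X Y T) x" using x by (simp add: T.graph.hnorm_nonneg)
qed

lemma hlim_proj:
  assumes s: "\<And>n. s n \<in> Domain T" and x: "x \<in> Domain T"
    and lim: "hlim X s x" "hlim Y (\<lambda>n. op_app T (s n)) (op_app T x)"
  shows "hlim BD (\<lambda>n. \<pi> (s n)) (\<pi> x)"
proof -
  have l: "hlim (graph_space X Y T) s x" using lim by (simp add: T.hlim_graph_iff s x)
  have "(\<lambda>n. hnorm BD (\<pi> (s n) - \<pi> x)) \<longlonglongrightarrow> 0"
  proof (rule tendsto_zero_le)
    show "(\<lambda>n. hnorm (graph_space X Y T) (s n - x)) \<longlonglongrightarrow> 0" using l by (simp add: hlim_def)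
    show "0 \<le> hnorm BD (\<pi> (s n) - \<pi> x)" for n
      by (intro BD.hnorm_nonneg BD.diff_mem decomposition s x)
    show "hnorm BD (\<pi> (s n) - \<pi> x) \<le> hnorm (graph_space X Y T) (s n - x)" for n
      using hnorm_proj_le[OF T.app_diff(1)[OF s x]] by (simp add: proj_diff s x)
  qed
  then show ?thesis using s x by (simp add: hlim_def decomposition)
qed

end

locale boundary_system = E: hilbert_space E + H: hilbert_space H
  for E :: "'e::complex_vector hspace" and H :: "'h::complex_vector hspace" +
  fixes G0 G :: "('e \<times> 'h) set" and D0 D :: "('h \<times> 'e) set"
  assumes closed_G0: "closed_operator E H G0" and dense_G0: "dense_in E (Domain G0)"
    and closed_D0: "closed_operator H E D0" and dense_D0: "dense_in H (Domain D0)"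
    and G0_le: "G0 \<subseteq> neg_op (adjoint_rel H E D0)"
    and G_eq: "G = neg_op (adjoint_rel H E D0)"
    and D_eq: "D = neg_op (adjoint_rel E H G0)"
begin

sublocale G0: closed_op E H G0
  by unfold_locales (rule closed_G0)

sublocale D0: closed_op H E D0
  by unfold_locales (rule closed_D0)

lemma mem_G: "(x, y) \<in> G \<longleftrightarrow> x \<in> hcarrier E \<and> y \<in> hcarrier H \<and>
    (\<forall>w\<in>Domain D0. hinner E (op_app D0 w) x + hinner H w y = 0)"
proof -
  have "- y \<in> hcarrier H \<longleftrightarrow> y \<in> hcarrier H" using H.neg_mem[of y] H.neg_mem[of "- y"] by auto
  then show ?thesis
    unfolding G_eq mem_neg_op mem_adjoint_rel
    by (auto simp: D0.mem_iff H.ip_neg_right eq_neg_iff_add_eq_0)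
qed

lemma mem_D: "(w, z) \<in> D \<longleftrightarrow> w \<in> hcarrier H \<and> z \<in> hcarrier E \<and>
    (\<forall>x\<in>Domain G0. hinner H (op_app G0 x) w + hinner E x z = 0)"
proof -
  have "- z \<in> hcarrier E \<longleftrightarrow> z \<in> hcarrier E" using E.neg_mem[of z] E.neg_mem[of "- z"] by auto
  then show ?thesis
    unfolding D_eq mem_neg_op mem_adjoint_rel
    by (auto simp: G0.mem_iff E.ip_neg_right eq_neg_iff_add_eq_0)
qed

lemma dual_le: "D0 \<subseteq> D"
proof (clarify, unfold mem_D, intro conjI ballI)
  fix w z x assume wz: "(w, z) \<in> D0" and x: "x \<in> Domain G0"
  have wm: "w \<in> Domain D0" "z = op_app D0 w" using wz by (auto simp: D0.mem_iff)
  have "(x, op_app G0 x) \<in> G" using G0_le G_eq G0.app_in[OF x] by blast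
  then have "hinner E z x + hinner H w (op_app G0 x) = 0" using wm by (simp add: mem_G)
  then have "cnj (hinner E z x + hinner H w (op_app G0 x)) = 0" by simp
  then show "hinner H (op_app G0 x) w + hinner E x z = 0"
    using x wm E.ip_commute[of x z] H.ip_commute[of "op_app G0 x" w] by (simp add: add.commute)
qed (use D0.subset_carrier in auto)

lemma dual: "boundary_system H E D0 D G0 G"
  using closed_G0 dense_G0 closed_D0 dense_D0 dual_le G_eq D_eq
  by unfold_locales simp_all

lemma closed_G: "closed_operator E H G"
proof -
  have "neg_op D0 \<subseteq> hcarrier H \<times> hcarrier E"
    using D0.subset_carrier E.neg_mem by (force simp: neg_op_def)
  then have "closed_operator E H (adjoint_rel H E (neg_op D0))"
    using dense_D0 by (intro closed_operator_adjoint_rel) (unfold_locales, simp_all)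
  then show ?thesis
    using neg_op_adjoint_rel[OF H.semi_inner_axioms E.semi_inner_axioms D0.subset_carrier]
    by (simp add: G_eq)
qed

sublocale G: closed_extension E H G0 G
  using G0_le by unfold_locales (auto simp: closed_G simp flip: G_eq)

sublocale D: closed_extension H E D0 D
  using dual_le by unfold_locales (auto simp: boundary_system.closed_G[OF dual])

lemma green_D0:
  assumes "w \<in> Domain D0" "x \<in> Domain G"
  shows "hinner E (op_app D w) x + hinner H w (op_app G x) = 0"
  using mem_G[of x "op_app G x"] G.T.app_in[OF assms(2)] assms(1) by (simp add: D.ext_app)

lemma green_G0:
  assumes "x \<in> Domain G0" "w \<in> Domain D"
  shows "hinner H (op_app G x) w + hinner E x (op_app D w) = 0"
  using mem_D[of w "op_app D w"] D.T.app_in[OF assms(2)] assms(1) by (simp add: G.ext_app)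

lemma boundary_D:
  assumes w: "w \<in> hcarrier D.BD"
  shows "op_app D w \<in> hcarrier G.BD" "op_app G (op_app D w) = w"
proof -
  have dom: "w \<in> Domain D" using w by (rule D.BD_dom)
  have "(op_app D w, w) \<in> G"
    unfolding mem_G using dom w by (auto simp: D.mem_BD D.ext_app add.commute)
  then have *: "op_app D w \<in> Domain G" "op_app G (op_app D w) = w" by (auto simp: G.T.mem_iff)
  then show "op_app G (op_app D w) = w" by blast
  show "op_app D w \<in> hcarrier G.BD"
    unfolding G.mem_BD using * green_G0[OF _ dom] by (simp add: add.commute)
qed

lemma green:
  assumes w: "w \<in> Domain D" and x: "x \<in> Domain G"
  shows "hinner H w (op_app G x) + hinner E (op_app D w) x =
    hinner G.BD (op_app D (D.\<pi> w)) (G.\<pi> x)"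
proof -
  define w1 x1 where "w1 = D.\<pi> w" and "x1 = G.\<pi> x"
  have w1: "w1 \<in> hcarrier D.BD" "w - w1 \<in> Domain D0" and x1: "x1 \<in> hcarrier G.BD" "x - x1 \<in> Domain G0"
    using D.decomposition[OF w] G.decomposition[OF x] by (simp_all add: w1_def x1_def)
  have dom: "w1 \<in> Domain D" "x1 \<in> Domain G" using D.BD_dom[OF w1(1)] G.BD_dom[OF x1(1)] .
  note [simp] = w x dom D.T.dom_mem D.T.app_mem G.T.dom_mem G.T.app_mem
  have "hinner E (op_app D w) x + hinner H w (op_app G x)
      = hinner E (op_app D w1) x + hinner H w1 (op_app G x)"
    using green_D0[OF w1(2) x] by (simp add: D.T.app_diff E.ip_simps H.ip_simps algebra_simps)
  moreover have "hinner H (op_app G x) w1 + hinner E x (op_app D w1)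
      = hinner H (op_app G x1) w1 + hinner E x1 (op_app D w1)"
    using green_G0[OF x1(2) dom(1)] by (simp add: G.T.app_diff E.ip_simps H.ip_simps algebra_simps)
  then have "cnj (hinner H (op_app G x) w1 + hinner E x (op_app D w1))
      = cnj (hinner H (op_app G x1) w1 + hinner E x1 (op_app D w1))" by simp
  then have "hinner H w1 (op_app G x) + hinner E (op_app D w1) x
      = hinner H w1 (op_app G x1) + hinner E (op_app D w1) x1"
    by (simp flip: E.ip_commute H.ip_commute)
  moreover have "hinner G.BD (op_app D w1) x1 = hinner E (op_app D w1) x1 + hinner H w1 (op_app G x1)"
    by (simp add: G.hinner_BD boundary_D[OF w1(1)])
  ultimately show ?thesis by (simp add: add.commute w1_def x1_def)
qed

definition boundary_form_rel :: "'e set \<Rightarrow> 'u::complex_vector hspace \<Rightarrow> ('e \<Rightarrow> 'u) \<Rightarrow> ('e \<times> 'e) set" where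
  "boundary_form_rel S U K = {(b, v) \<in> (S \<inter> hcarrier G.BD) \<times> hcarrier G.BD.
     \<forall>x\<in>S \<inter> hcarrier G.BD. hinner U (K b) (K x) = hinner G.BD v x}"

lemma form_domain_eq:
  fixes U :: "'u::complex_vector hspace" and K :: "'e \<Rightarrow> 'u"
  assumes U: "hilbert_space U" and sub: "complex_vector.subspace (hcarrier E0)"
    and S: "Domain G0 \<subseteq> hcarrier E0" "hcarrier E0 \<subseteq> Domain G"
    and L: "\<And>x. x \<in> hcarrier E0 \<Longrightarrow> L x = op_app G x"
    and K_mem: "\<And>x. x \<in> hcarrier E0 \<Longrightarrow> K x \<in> hcarrier U"
    and K_add: "\<And>x y. x \<in> hcarrier E0 \<Longrightarrow> y \<in> hcarrier E0 \<Longrightarrow> K (x + y) = K x + K y"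
    and K0: "\<And>x. x \<in> Domain G0 \<Longrightarrow> K x = 0"
  shows "form_domain E H E0 U L K = {(u, w) \<in> Domain G \<times> Domain D.
    (G.\<pi> u, op_app D (D.\<pi> w)) \<in> boundary_form_rel (hcarrier E0) U K}"
proof -
  interpret U: hilbert_space U by fact
  let ?S = "hcarrier E0"
  have dom [simp]: "x \<in> Domain G" if "x \<in> ?S" for x using S(2) that by (rule subsetD)
  have core [simp]: "x \<in> ?S" if "x \<in> Domain G0" for x using S(1) that by (rule subsetD)
  have S_iff: "G.\<pi> x \<in> ?S \<longleftrightarrow> x \<in> ?S" if x: "x \<in> Domain G" for x
    using complex_vector.subspace_add[OF sub _ core[OF G.decomposition(2)[OF x]], of "G.\<pi> x"]
      complex_vector.subspace_diff[OF sub _ core[OF G.decomposition(2)[OF x]], of x] by auto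
  have K_proj: "K (G.\<pi> x) = K x" if x: "x \<in> ?S" for x
    using K_add[of "G.\<pi> x" "x - G.\<pi> x"] S_iff[of x] x G.decomposition(2)[of x] K0 by simp
  have mem: "(u, w) \<in> form_domain E H E0 U L K \<longleftrightarrow> u \<in> ?S \<and> w \<in> hcarrier H \<and>
      (\<exists>e\<in>hcarrier E. \<forall>x\<in>?S. hinner U (K u) (K x) - hinner H w (op_app G x) = hinner E e x)" for u w
    by (auto simp: form_domain_def dual_op_def embedded_in_dual_def image_iff fun_eq_iff restrict_def L)
  have "(u, w) \<in> form_domain E H E0 U L K \<longleftrightarrow> u \<in> Domain G \<and> w \<in> Domain D \<and>
    (G.\<pi> u, op_app D (D.\<pi> w)) \<in> boundary_form_rel ?S U K" for u w
  proof
    assume "(u, w) \<in> form_domain E H E0 U L K"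
    then obtain e where u: "u \<in> ?S" and w: "w \<in> hcarrier H" and e: "e \<in> hcarrier E"
      and eq: "\<And>x. x \<in> ?S \<Longrightarrow> hinner U (K u) (K x) - hinner H w (op_app G x) = hinner E e x"
      unfolding mem by blast
    have "(w, e) \<in> D"
      unfolding mem_D
    proof (intro conjI ballI w e)
      fix x assume x: "x \<in> Domain G0"
      then have "hinner U (K u) (K x) = 0" using K0 K_mem[OF u] by (simp add: U.ip_zero_right)
      then have "hinner E e x + hinner H w (op_app G x) = 0"
        using eq[OF core[OF x]] by (simp add: eq_commute[of _ "hinner E e x"])
      then have "cnj (hinner E e x + hinner H w (op_app G x)) = 0" by simp
      then show "hinner H (op_app G0 x) w + hinner E x e = 0"
        using x w e by (simp add: G.ext_app G.ext_dom add.commute flip: E.ip_commute H.ip_commute)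
    qed
    then have wD: "w \<in> Domain D" and e_eq: "e = op_app D w" by (auto simp: D.T.mem_iff)
    have "(G.\<pi> u, op_app D (D.\<pi> w)) \<in> boundary_form_rel ?S U K"
      unfolding boundary_form_rel_def
    proof (clarsimp, intro conjI ballI)
      show "G.\<pi> u \<in> ?S" "G.\<pi> u \<in> hcarrier G.BD" using u S_iff G.decomposition(1) by simp_all
      show "op_app D (D.\<pi> w) \<in> hcarrier G.BD" using boundary_D D.decomposition(1)[OF wD] by blast
      fix x assume "x \<in> ?S \<inter> hcarrier G.BD"
      then have x: "x \<in> ?S" "G.\<pi> x = x" by (simp_all add: G.proj_BD)
      have "hinner U (K (G.\<pi> u)) (K x) = hinner H w (op_app G x) + hinner E (op_app D w) x"
        using eq[OF x(1)] K_proj[OF u] by (simp add: e_eq diff_eq_eq add.commute)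
      then show "hinner U (K (G.\<pi> u)) (K x) = hinner G.BD (op_app D (D.\<pi> w)) x"
        using green[OF wD dom[OF x(1)]] x by simp
    qed
    then show "u \<in> Domain G \<and> w \<in> Domain D \<and>
        (G.\<pi> u, op_app D (D.\<pi> w)) \<in> boundary_form_rel ?S U K"
      using u wD by simp
  next
    assume *: "u \<in> Domain G \<and> w \<in> Domain D \<and>
      (G.\<pi> u, op_app D (D.\<pi> w)) \<in> boundary_form_rel ?S U K"
    then have w: "w \<in> Domain D" and u: "u \<in> ?S" using S_iff by (auto simp: boundary_form_rel_def)
    have "hinner U (K u) (K x) - hinner H w (op_app G x) = hinner E (op_app D w) x"
      if x: "x \<in> ?S" for x
    proof -
      have "G.\<pi> x \<in> ?S \<inter> hcarrier G.BD" using x S_iff[of x] G.decomposition(1)[of x] by simp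
      then have "hinner U (K (G.\<pi> u)) (K (G.\<pi> x)) = hinner G.BD (op_app D (D.\<pi> w)) (G.\<pi> x)"
        using * by (auto simp: boundary_form_rel_def)
      then show ?thesis using green[OF w dom[OF x]] by (simp add: K_proj u x diff_eq_eq add.commute)
    qed
    then show "(u, w) \<in> form_domain E H E0 U L K"
      unfolding mem using u w by (auto intro: D.T.app_mem)
  qed
  then show ?thesis by auto
qed

end

context boundary_system begin

lemma boundary_form_rel_maximal:
  fixes U :: "'u::complex_vector hspace" and K :: "'e \<Rightarrow> 'u"
  assumes E0: "hilbert_space E0" and U: "hilbert_space U" and K: "K \<in> bounded_ops E0 U"
    and hyp: "hypothesis E H G0 G E0 U L K"
  defines "h \<equiv> boundary_form_rel (hcarrier E0) U K"
  shows "h \<subseteq> hcarrier G.BD \<times> hcarrier G.BD"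
    and "maximal_monotone_rel G.BD h" and "selfadjoint_rel G.BD h"
    and "form_domain E H E0 U L K =
      {(u, w) \<in> Domain G \<times> Domain D. (G.\<pi> u, op_app D (D.\<pi> w)) \<in> h}"
proof -
  interpret E0: hilbert_space E0 by fact
  interpret U: hilbert_space U by fact
  let ?S = "hcarrier E0"
  have K_mem [simp]: "K x \<in> hcarrier U" if "x \<in> ?S" for x
    using K that by (auto simp: bounded_ops_def)
  have K_add: "K (x + y) = K x + K y" if "x \<in> ?S" "y \<in> ?S" for x y
    using K that by (simp add: bounded_ops_def)
  have K_diff: "K (x - y) = K x - K y" if "x \<in> ?S" "y \<in> ?S" for x y
    using K_add[of "x - y" y] that by simp
  have K0: "K x = 0" if "x \<in> Domain G0" for x using hyp that by (simp add: hypothesis_def)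
  have graph_L: "graph_on ?S L \<subseteq> G" and G0_L: "G0 \<subseteq> graph_on ?S L" using hyp by (simp_all add: hypothesis_def)
  have S_dom: "x \<in> Domain G" and L: "L x = op_app G x" if "x \<in> ?S" for x
  proof -
    have "(x, L x) \<in> G" using graph_L that by (auto simp: graph_on_def)
    then show "x \<in> Domain G" "L x = op_app G x" by (auto simp: G.T.mem_iff)
  qed
  have core_S: "x \<in> ?S" if "x \<in> Domain G0" for x using G0_L that by (auto simp: graph_on_def)
  show "form_domain E H E0 U L K =
      {(u, w) \<in> Domain G \<times> Domain D. (G.\<pi> u, op_app D (D.\<pi> w)) \<in> h}"
    unfolding h_def using U E0.subspace_hcarrier core_S S_dom L K_mem K_add K0
    by (intro form_domain_eq) auto
  show h_sub: "h \<subseteq> hcarrier G.BD \<times> hcarrier G.BD" by (auto simp: h_def boundary_form_rel_def)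
  have h_iff: "(b, v) \<in> h \<longleftrightarrow> b \<in> ?S \<and> b \<in> hcarrier G.BD \<and> v \<in> hcarrier G.BD \<and>
      (\<forall>x\<in>?S \<inter> hcarrier G.BD. hinner U (K b) (K x) = hinner G.BD v x)" for b v
    by (auto simp: h_def boundary_form_rel_def)
  have mono: "monotone_rel G.BD h"
    unfolding monotone_rel_def
  proof (intro conjI h_sub, clarify)
    fix b v b' v' assume *: "(b, v) \<in> h" "(b', v') \<in> h"
    then have [simp]: "b \<in> ?S" "b' \<in> ?S" "b \<in> hcarrier G.BD" "b' \<in> hcarrier G.BD"
      "v \<in> hcarrier G.BD" "v' \<in> hcarrier G.BD" by (auto simp: h_iff)
    have d: "b - b' \<in> ?S \<inter> hcarrier G.BD" by simp
    have "hinner U (K b) (K (b - b')) = hinner G.BD v (b - b')"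
      "hinner U (K b') (K (b - b')) = hinner G.BD v' (b - b')"
      using * d unfolding h_iff by blast+
    then have "hinner G.BD (v - v') (b - b') = hinner U (K b - K b') (K (b - b'))"
      by (simp add: G.BD.ip_diff_left U.ip_diff_left)
    also have "\<dots> = hinner U (K (b - b')) (K (b - b'))" by (simp add: K_diff)
    finally have "hinner G.BD (v - v') (b - b') = hinner U (K (b - b')) (K (b - b'))" .
    then have "0 \<le> Re (hinner G.BD (v - v') (b - b'))" by (simp add: U.ip_nonneg)
    then show "0 \<le> Re (hinner G.BD (b - b') (v - v'))"
      using G.BD.ip_commute[of "b - b'" "v - v'"] by simp
  qed
  have sym: "hinner G.BD v b' = hinner G.BD b v'" if "(b, v) \<in> h" "(b', v') \<in> h" for b v b' v'
    using that U.ip_commute[of "K b" "K b'"] G.BD.ip_commute[of b v'] by (simp add: h_iff)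
  let ?\<Gamma> = "graph_on ?S (\<lambda>u. (L u, K u))"
  have HU: "hilbert_space (H \<oplus>\<^sub>H U)" by (intro hilbert_space_hsum H.hilbert_space_axioms U)
  interpret \<Gamma>: closed_op E "H \<oplus>\<^sub>H U" ?\<Gamma>
    using hyp by (intro closed_op.intro E.hilbert_space_axioms HU closed_op_axioms.intro)
      (simp add: hypothesis_def)
  have range: "\<exists>b. (b, f - b) \<in> h" if f: "f \<in> hcarrier G.BD" for f
  proof -
    have [simp]: "f \<in> Domain G" using f by (rule G.BD_dom)
    have "(f, (op_app G f, 0)) \<in> hcarrier (E \<oplus>\<^sub>H (H \<oplus>\<^sub>H U))" by simp
    from \<Gamma>.XY.projection_exists[OF \<Gamma>.subspace_T \<Gamma>.closedin_T this] obtain p where p: "p \<in> ?\<Gamma>"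
      and orth: "\<And>s. s \<in> ?\<Gamma> \<Longrightarrow> hinner (E \<oplus>\<^sub>H (H \<oplus>\<^sub>H U)) s ((f, (op_app G f, 0)) - p) = 0" by blast
    obtain b where b [simp]: "b \<in> ?S" and pb: "p = (b, (L b, K b))" using p by (auto simp: graph_on_def)
    have [simp]: "b \<in> Domain G" by (simp add: S_dom)
    have eq: "hinner E x (f - b) + hinner H (op_app G x) (op_app G (f - b)) = hinner U (K x) (K b)"
      if x: "x \<in> ?S" for x
    proof -
      have "(x, (L x, K x)) \<in> ?\<Gamma>" using x by (auto simp: graph_on_def)
      from orth[OF this] show ?thesis
        using x by (simp add: hinner_hsum pb L G.T.app_diff U.ip_neg_right algebra_simps)
    qed
    have fb: "f - b \<in> hcarrier G.BD"
      unfolding G.mem_BD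
    proof (intro conjI ballI)
      show "f - b \<in> Domain G" by (simp add: G.T.app_diff)
      fix x assume "x \<in> Domain G0"
      then show "hinner E x (f - b) + hinner H (op_app G x) (op_app G (f - b)) = 0"
        using eq[of x] core_S[of x] by (simp add: K0 U.ip_zero_left)
    qed
    have bBD: "b \<in> hcarrier G.BD" using G.BD.diff_mem[OF f fb] by simp
    have "hinner U (K b) (K x) = hinner G.BD (f - b) x" if x: "x \<in> ?S" "x \<in> hcarrier G.BD" for x
    proof -
      have "hinner G.BD x (f - b) = hinner U (K x) (K b)" using eq[OF x(1)] by (simp add: G.hinner_BD)
      then show ?thesis
        using x U.ip_commute[of "K b" "K x"] G.BD.ip_commute[OF fb x(2)] by simp
    qed
    then have "(b, f - b) \<in> h" using fb bBD by (simp add: h_iff)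
    then show ?thesis by blast
  qed
  show "maximal_monotone_rel G.BD h" "selfadjoint_rel G.BD h"
    by (rule G.BD.monotone_symmetric_range_imp[OF mono sym range]; assumption)+
qed

lemma form_realization:
  assumes mono: "monotone_rel G.BD h" and sa: "selfadjoint_rel G.BD h"
  obtains E0 :: "'e hspace" and U :: "'e hspace" and L K where
    "hilbert_space E0" "hilbert_space U" "L \<in> bounded_ops E0 H" "K \<in> bounded_ops E0 U"
    "hypothesis E H G0 G E0 U L K"
    "form_domain E H E0 U L K =
      {(u, w) \<in> Domain G \<times> Domain D. (G.\<pi> u, op_app D (D.\<pi> w)) \<in> h}"
proof -
  interpret h: positive_selfadjoint G.BD h by unfold_locales fact+
  obtain B and U :: "'e hspace" and k where U: "hilbert_space U"
    and k: "closed_operator G.BD U (graph_on B k)"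
    and h: "h = {(b, v) \<in> B \<times> hcarrier G.BD. \<forall>x\<in>B. hinner U (k b) (k x) = hinner G.BD v x}"
    by (rule h.factorization)
  interpret U: hilbert_space U by fact
  interpret k: closed_op G.BD U "graph_on B k"
    by (intro closed_op.intro G.BD.hilbert_space_axioms U closed_op_axioms.intro k)
  have B_BD: "b \<in> hcarrier G.BD" and k_mem: "k b \<in> hcarrier U" if "b \<in> B" for b
    using that k.dom_mem[of b] k.app_mem[of b] by simp_all
  have B0: "0 \<in> B" and k0: "k 0 = 0" using k.app_zero by auto
  have k_add: "x + y \<in> B" "k (x + y) = k x + k y" if "x \<in> B" "y \<in> B" for x y
    using that k.app_add[of x y] by auto
  have k_scale: "c *\<^sub>C x \<in> B" "k (c *\<^sub>C x) = c *\<^sub>C k x" if "x \<in> B" for c x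
    using that k.app_scale[of x c] by auto
  define S where "S = {x \<in> Domain G. G.\<pi> x \<in> B}"
  define L where "L = op_app G"
  define K where "K = (\<lambda>x. k (G.\<pi> x))"
  have S_dom: "x \<in> Domain G" and S_proj: "G.\<pi> x \<in> B" if "x \<in> S" for x
    using that by (simp_all add: S_def)
  have core_S: "x \<in> S" and K0: "K x = 0" if "x \<in> Domain G0" for x
    using that by (simp_all add: S_def K_def G.ext_dom G.proj_core B0 k0)
  have sub_S: "complex_vector.subspace S"
    by (rule complex_vector.subspaceI)
      (auto simp: S_def G.proj_add G.proj_scale k_add k_scale G.T.app_add G.T.app_scale
        G.T.app_zero G.proj_core G0.app_zero B0)
  note [simp] = S_dom
  have L_mem: "L x \<in> hcarrier H" and K_mem: "K x \<in> hcarrier U" if "x \<in> S" for x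
    using that k_mem[OF S_proj] by (simp_all add: L_def K_def)
  have L_add: "L (x + y) = L x + L y" and K_add: "K (x + y) = K x + K y" if "x \<in> S" "y \<in> S" for x y
    using that by (simp_all add: L_def K_def G.T.app_add G.proj_add k_add S_proj)
  have L_scale: "L (c *\<^sub>C x) = c *\<^sub>C L x" and K_scale: "K (c *\<^sub>C x) = c *\<^sub>C K x" if "x \<in> S" for c x
    using that by (simp_all add: L_def K_def G.T.app_scale G.proj_scale k_scale S_proj)
  have HU: "hilbert_space (H \<oplus>\<^sub>H U)" by (intro hilbert_space_hsum H.hilbert_space_axioms U)
  define \<Gamma> where "\<Gamma> = graph_on S (\<lambda>x. (L x, K x))"
  have closed_\<Gamma>: "closed_operator E (H \<oplus>\<^sub>H U) \<Gamma>"
    unfolding \<Gamma>_def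
  proof (rule closed_operator_graph_onI[OF E.hilbert_space_axioms HU sub_S])
    show "S \<subseteq> hcarrier E" by auto
    fix s x p assume s: "\<And>n. s n \<in> S" and x: "hlim E s x"
      and "hlim (H \<oplus>\<^sub>H U) (\<lambda>n. (L (s n), K (s n))) p"
    then have y: "hlim H (\<lambda>n. op_app G (s n)) (fst p)" and z: "hlim U (\<lambda>n. k (G.\<pi> (s n))) (snd p)"
      by (simp_all add: hlim_hsum_iff H.semi_inner_axioms U.semi_inner_axioms L_def K_def)
    note Gx = G.T.closed_seq[OF S_dom[OF s] x y]
    have "hlim G.BD (\<lambda>n. G.\<pi> (s n)) (G.\<pi> x)"
      using y Gx by (intro G.hlim_proj x) (simp_all add: s)
    moreover have "hlim U (\<lambda>n. op_app (graph_on B k) (G.\<pi> (s n))) (snd p)"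
      using z by (simp add: S_proj s)
    ultimately have "G.\<pi> x \<in> B" "k (G.\<pi> x) = snd p"
      using k.closed_seq[of "\<lambda>n. G.\<pi> (s n)" "G.\<pi> x" "snd p"] S_proj[OF s] by auto
    then show "x \<in> S \<and> (L x, K x) = p"
      using Gx by (simp add: S_def L_def K_def prod_eq_iff del: S_dom)
  qed (simp_all add: L_mem K_mem L_add K_add L_scale K_scale)
  interpret \<Gamma>: closed_op E "H \<oplus>\<^sub>H U" \<Gamma>
    by (intro closed_op.intro E.hilbert_space_axioms HU closed_op_axioms.intro closed_\<Gamma>)
  define E0 where "E0 = graph_space E (H \<oplus>\<^sub>H U) \<Gamma>"
  have dom_\<Gamma>: "Domain \<Gamma> = S" and app_\<Gamma>: "x \<in> S \<Longrightarrow> op_app \<Gamma> x = (L x, K x)" for x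
    by (simp_all add: \<Gamma>_def)
  have S_E0: "hcarrier E0 = S" by (simp add: E0_def dom_\<Gamma>)
  have E0: "hilbert_space E0" unfolding E0_def by (rule \<Gamma>.graph.hilbert_space_axioms)
  interpret E0: hilbert_space E0 by fact
  have norm_LK: "hnorm H (L x) \<le> 1 * hnorm E0 x" "hnorm U (K x) \<le> 1 * hnorm E0 x"
    and norm_E: "hnorm E x \<le> hnorm E0 x" if "x \<in> S" for x
    using \<Gamma>.hnorm_le_graph[of x] that L_mem[OF that] K_mem[OF that]
      hnorm_fst_le[OF H.semi_inner_axioms U.semi_inner_axioms, of "(L x, K x)"]
      hnorm_snd_le[OF H.semi_inner_axioms U.semi_inner_axioms, of "(L x, K x)"]
    by (simp_all add: E0_def dom_\<Gamma> app_\<Gamma>)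
  have "L \<in> bounded_ops E0 H" "K \<in> bounded_ops E0 U"
    unfolding bounded_ops_def S_E0
    using L_mem L_add L_scale norm_LK(1) K_mem K_add K_scale norm_LK(2) by blast+
  moreover have "hypothesis E H G0 G E0 U L K"
    unfolding hypothesis_def
  proof (intro conjI ballI)
    have "S \<subseteq> hcarrier E" "Domain G0 \<subseteq> S" using core_S by auto
    then show "dense_in E (hcarrier E0)"
      using dense_G0 unfolding E.dense_in_iff S_E0 by (meson subsetD)
    show "continuous_map (htopology E0) (htopology E) id"
      unfolding E0.metric_continuous_map[OF E.Metric_space_axioms]
    proof (intro conjI ballI allI impI)
      show "id ` hcarrier E0 \<subseteq> hcarrier E" by (auto simp: S_E0)
      fix a and e :: real assume a: "a \<in> hcarrier E0" and e: "e > 0"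
      have "hdist E (id a) (id x) < e" if "x \<in> hcarrier E0" "hdist E0 a x < e" for x
        using that a norm_E[of "a - x"] complex_vector.subspace_diff[OF sub_S, of a x]
        by (simp add: hdist_def S_E0)
      then show "\<exists>\<delta>>0. \<forall>x. x \<in> hcarrier E0 \<and> hdist E0 a x < \<delta> \<longrightarrow> hdist E (id a) (id x) < e"
        using e by blast
    qed
    show "closed_operator E (H \<oplus>\<^sub>H U) (graph_on (hcarrier E0) (\<lambda>u. (L u, K u)))"
      using closed_\<Gamma> by (simp add: \<Gamma>_def S_E0)
    show "G0 \<subseteq> graph_on (hcarrier E0) L"
      using core_S G.T.app_eq G.extends unfolding S_E0 graph_on_def L_def by fastforce
    show "graph_on (hcarrier E0) L \<subseteq> G" using G.T.app_in by (auto simp: S_E0 graph_on_def L_def)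
  qed (rule K0)
  moreover have "boundary_form_rel (hcarrier E0) U K = h"
  proof -
    have SB: "S \<inter> hcarrier G.BD = B"
      using B_BD G.BD_dom by (auto simp: S_def G.proj_BD simp del: S_dom)
    have "K b = k b" if "b \<in> B" for b using B_BD[OF that] by (simp add: K_def G.proj_BD)
    then show ?thesis unfolding boundary_form_rel_def h S_E0 SB by auto
  qed
  moreover have "form_domain E H E0 U L K = {(u, w) \<in> Domain G \<times> Domain D.
      (G.\<pi> u, op_app D (D.\<pi> w)) \<in> boundary_form_rel (hcarrier E0) U K}"
    by (rule form_domain_eq[OF U])
      (use core_S in \<open>auto simp: S_E0 sub_S L_def K_mem K_add K0\<close>)
  ultimately show thesis using that[OF E0 U] by simp
qed

end

theorem theorem3p2:
  fixes E :: "'e::complex_vector hspace" and H :: "'h::complex_vector hspace"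
    and G0 G :: "('e \<times> 'h) set" and D0 D :: "('h \<times> 'e) set"
    and A :: "(('e \<times> 'h) \<times> ('e \<times> 'h)) set"
  assumes "hilbert_space E" and "hilbert_space H"
    and "closed_operator E H G0" and "dense_in E (Domain G0)"
    and "closed_operator H E D0" and "dense_in H (Domain D0)"
    and "G0 \<subseteq> neg_op (adjoint_rel H E D0)"
    and "G = neg_op (adjoint_rel H E D0)"
    and "D = neg_op (adjoint_rel E H G0)"
    and "A \<subseteq> block_op D G"
  shows
    "((\<exists>(E0 :: 'e hspace) (U :: 'e hspace) L K.
         hilbert_space E0 \<and> hilbert_space U \<and> L \<in> bounded_ops E0 H \<and> K \<in> bounded_ops E0 U
         \<and> hypothesis E H G0 G E0 U L K
         \<and> Domain A = form_domain E H E0 U L K)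
      \<longleftrightarrow>
      (\<exists>h. h \<subseteq> hcarrier (boundary_space E H G0 G) \<times> hcarrier (boundary_space E H G0 G)
         \<and> maximal_monotone_rel (boundary_space E H G0 G) h
         \<and> selfadjoint_rel (boundary_space E H G0 G) h
         \<and> Domain A = {(u, w) \<in> Domain G \<times> Domain D.
              (boundary_proj E H G0 G u, op_app D (boundary_proj H E D0 D w)) \<in> h}))
     \<and>
     ((\<exists>(E0 :: 'e hspace) (U :: 'u::complex_vector hspace) L K.
         hilbert_space E0 \<and> hilbert_space U \<and> L \<in> bounded_ops E0 H \<and> K \<in> bounded_ops E0 U
         \<and> hypothesis E H G0 G E0 U L K
         \<and> Domain A = form_domain E H E0 U L K)
      \<longrightarrow>
      (\<exists>h. h \<subseteq> hcarrier (boundary_space E H G0 G) \<times> hcarrier (boundary_space E H G0 G)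
         \<and> maximal_monotone_rel (boundary_space E H G0 G) h
         \<and> selfadjoint_rel (boundary_space E H G0 G) h
         \<and> Domain A = {(u, w) \<in> Domain G \<times> Domain D.
              (boundary_proj E H G0 G u, op_app D (boundary_proj H E D0 D w)) \<in> h}))"
proof -
  interpret boundary_system E H G0 G D0 D
    using assms by (intro boundary_system.intro boundary_system_axioms.intro)
  define boundary where "boundary \<longleftrightarrow> (\<exists>h. h \<subseteq> hcarrier G.BD \<times> hcarrier G.BD
    \<and> maximal_monotone_rel G.BD h \<and> selfadjoint_rel G.BD h
    \<and> Domain A = {(u, w) \<in> Domain G \<times> Domain D. (G.\<pi> u, op_app D (D.\<pi> w)) \<in> h})"
  have form_imp: boundary
    if "hilbert_space E0 \<and> hilbert_space U \<and> L \<in> bounded_ops E0 H \<and> K \<in> bounded_ops E0 U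
      \<and> hypothesis E H G0 G E0 U L K \<and> Domain A = form_domain E H E0 U L K"
    for E0 and U :: "'v::complex_vector hspace" and L K
  proof -
    have "hilbert_space E0" "hilbert_space U" "K \<in> bounded_ops E0 U" "hypothesis E H G0 G E0 U L K"
      using that by blast+
    note h = boundary_form_rel_maximal[OF this]
    have "Domain A = form_domain E H E0 U L K" using that by blast
    then show ?thesis unfolding boundary_def using h by (intro exI conjI) (assumption | simp)+
  qed
  have imp_form: "\<exists>(E0 :: 'e hspace) (U :: 'e hspace) L K.
      hilbert_space E0 \<and> hilbert_space U \<and> L \<in> bounded_ops E0 H \<and> K \<in> bounded_ops E0 U
      \<and> hypothesis E H G0 G E0 U L K \<and> Domain A = form_domain E H E0 U L K" if boundary
  proof -
    obtain h where h: "maximal_monotone_rel G.BD h" "selfadjoint_rel G.BD h"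
      and A: "Domain A = {(u, w) \<in> Domain G \<times> Domain D. (G.\<pi> u, op_app D (D.\<pi> w)) \<in> h}"
      using \<open>boundary\<close> unfolding boundary_def by blast
    have "monotone_rel G.BD h" using h(1) by (simp add: maximal_monotone_rel_def)
    then obtain E0 :: "'e hspace" and U :: "'e hspace" and L K where
      "hilbert_space E0" "hilbert_space U" "L \<in> bounded_ops E0 H" "K \<in> bounded_ops E0 U"
      "hypothesis E H G0 G E0 U L K" "form_domain E H E0 U L K =
        {(u, w) \<in> Domain G \<times> Domain D. (G.\<pi> u, op_app D (D.\<pi> w)) \<in> h}"
      using h(2) by (rule form_realization)
    then show ?thesis unfolding A by (intro exI conjI) (assumption | rule sym)+
  qed
  show ?thesis
    unfolding boundary_def[symmetric]
    by (rule conjI; (rule iffI)?; (rule impI)?; (elim exE)?; (rule form_imp imp_form; assumption))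
qed

end
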